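(* Let $t>0$ and let $\xi$ be a stationary marked random connection model on $\mathbb{R}^d\times\mathbb{M}$ based on a Poisson process with intensity measure $t\,\lambda_d\otimes\mathbb{Q}$. Assume that there exist a measurable set $A\subset\mathbb{M}$ with $\mathbb{Q}(A)>0$ and some $p_0\in\mathbb{M}$ such that $$d_\varphi(p,q)\ge d_\varphi(p,p_0),\qquad \text{for }\mathbb{Q}^2\text{-a.e. }(p,q)\in\mathbb{M}\times A .$$ Assume also that $$\sup_{n\ge1}d_\varphi^{(n)}(p_0,q)>0,\qquad\text{for }\mathbb{Q}\text{-a.e. }q\in\mathbb{M}.$$ Then $\xi$ is irreducible.
   Context: Stationary marked random connection model (RCM). $\mathbb{M}$ is a complete separable metric space with a Borel probability measure $\mathbb{Q}$, $\mathbb{X}=\mathbb{R}^d\times\mathbb{M}$ ($d\ge1$), $\lambda_d$ is Lebesgue measure and $\lambda=\lambda_d\otimes\mathbb{Q}$. The connection function $\varphi\colon\mathbb{X}^2\to[0,1]$ is measurable, symmetric, and satisfies $\varphi((x,p),(y,q))=\varphi((0,p),(y-x,q))$; one writes $\varphi(x,p,q):=\varphi((0,p),(x,q))$ and assumes $\iint\varphi(x,p,q)\,dx\,\mathbb{Q}^2(d(p,q))<\infty$. $\eta$ is a Poisson process on $\mathbb{X}$ with intensity measure $t\lambda$, and $\xi$ is the random graph with vertex set $\eta$ in which, given $\eta$, each pair of distinct points $(x,p),(y,q)\in\eta$ is joined by an edge with probability $\varphi((x,p),(y,q))$, independently for different pairs. For $z_1,z_2\in\mathbb{X}$, $\xi^{z_1,z_2}$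 is the RCM based on $\eta+\delta_{z_1}+\delta_{z_2}$. $\xi$ is irreducible if $\mathbb{P}(z_1\leftrightarrow z_2\text{ in }\xi^{z_1,z_2})>0$ for $\lambda^2$-a.e. $(z_1,z_2)\in\mathbb{X}^2$, where $\leftrightarrow$ denotes connection by a path. Define $\varphi^{(1)}:=\varphi$ and $\varphi^{(n+1)}(z_1,z_2):=\int\varphi^{(n)}(z_1,z)\varphi(z,z_2)\,\lambda(dz)$ for $z_1,z_2\in\mathbb{X}$, $n\in\mathbb{N}$; write $\varphi^{(n)}(x,p,q):=\varphi^{(n)}((0,p),(x,q))$, and $d_\varphi^{(n)}(p,q):=\int_{\mathbb{R}^d}\varphi^{(n)}(x,p,q)\,dx\in[0,\infty]$ for $p,q\in\mathbb{M}$, with $d_\varphi(p,q):=d_\varphi^{(1)}(p,q)$. *)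

theory Defs
  imports "HOL-Probability.Probability"
begin

text \<open>
  The space of marked points is \<open>'a \<times> 'm\<close>, where \<open>'a :: euclidean_space\<close> is \<open>\<real>\<^sup>d\<close> (so $d \ge 1$) and
  \<open>'m :: polish_space\<close> is the complete separable metric space of marks.
\<close>

definition marked_lebesgue ::
    "'m::polish_space measure \<Rightarrow> ('a::euclidean_space \<times> 'm) measure" where
  "marked_lebesgue Q = lborel \<Otimes>\<^sub>M Q"


section \<open>Connection functions\<close>

definition stationary_connection_function ::
    "'m::polish_space measure \<Rightarrow> ('a::euclidean_space \<times> 'm \<Rightarrow> 'a \<times> 'm \<Rightarrow> real) \<Rightarrow> bool" where
  "stationary_connection_function Q \<phi> \<longleftrightarrow>
     (\<lambda>(z, w). \<phi> z w) \<in> borel_measurable (borel \<Otimes>\<^sub>M borel) \<and>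
     (\<forall>z w. 0 \<le> \<phi> z w \<and> \<phi> z w \<le> 1) \<and>
     (\<forall>z w. \<phi> z w = \<phi> w z) \<and>
     (\<forall>x p y q. \<phi> (x, p) (y, q) = \<phi> (0, p) (y - x, q)) \<and>
     (\<integral>\<^sup>+ (p, q). (\<integral>\<^sup>+ x. ennreal (\<phi> (0, p) (x, q)) \<partial>lborel) \<partial>(Q \<Otimes>\<^sub>M Q)) < \<infinity>"

text \<open>\<open>conn_iter L \<phi> n\<close> is $\varphi^{(n)}$ for $n \ge 1$; the value at \<open>0\<close> is a dummy.\<close>

fun conn_iter :: "'x measure \<Rightarrow> ('x \<Rightarrow> 'x \<Rightarrow> real) \<Rightarrow> nat \<Rightarrow> 'x \<Rightarrow> 'x \<Rightarrow> ennreal" where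
  "conn_iter L \<phi> 0 z\<^sub>1 z\<^sub>2 = 0"
| "conn_iter L \<phi> (Suc 0) z\<^sub>1 z\<^sub>2 = ennreal (\<phi> z\<^sub>1 z\<^sub>2)"
| "conn_iter L \<phi> (Suc (Suc n)) z\<^sub>1 z\<^sub>2 =
     (\<integral>\<^sup>+ z. conn_iter L \<phi> (Suc n) z\<^sub>1 z * ennreal (\<phi> z z\<^sub>2) \<partial>L)"

definition conn_degree ::
    "'m::polish_space measure \<Rightarrow> ('a::euclidean_space \<times> 'm \<Rightarrow> 'a \<times> 'm \<Rightarrow> real) \<Rightarrow> nat
      \<Rightarrow> 'm \<Rightarrow> 'm \<Rightarrow> ennreal" where
  "conn_degree Q \<phi> n p q =
     (\<integral>\<^sup>+ x. conn_iter (marked_lebesgue Q) \<phi> n (0, p) (x, q) \<partial>lborel)"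


section \<open>Poisson processes\<close>

text \<open>
  A point process is a random measure with values in $\{0, 1, \ldots, \infty\}$. The Poisson
  probabilities are written out, as \<open>poisson_pmf\<close> excludes the parameter \<open>0\<close>; for the parameter
  \<open>\<infinity>\<close> the Poisson distribution is the point mass at \<open>\<infinity>\<close>.
\<close>

definition point_process :: "'w measure \<Rightarrow> 'x measure \<Rightarrow> ('w \<Rightarrow> 'x measure) \<Rightarrow> bool" where
  "point_process \<Omega> N \<eta> \<longleftrightarrow>
     (\<forall>\<omega>\<in>space \<Omega>. sets (\<eta> \<omega>) = sets N) \<and>
     (\<forall>\<omega>\<in>space \<Omega>. \<forall>B\<in>sets N. emeasure (\<eta> \<omega>) B \<in> range of_nat \<union> {\<infinity>}) \<and>
     (\<forall>B\<in>sets N. (\<lambda>\<omega>. emeasure (\<eta> \<omega>) B) \<in> borel_measurable \<Omega>)"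

definition poisson_process :: "'w measure \<Rightarrow> 'x measure \<Rightarrow> ('w \<Rightarrow> 'x measure) \<Rightarrow> bool" where
  "poisson_process \<Omega> \<mu> \<eta> \<longleftrightarrow>
     point_process \<Omega> \<mu> \<eta> \<and>
     (\<forall>B\<in>sets \<mu>. emeasure \<mu> B < \<infinity> \<longrightarrow>
        (\<forall>k. measure \<Omega> {\<omega>\<in>space \<Omega>. emeasure (\<eta> \<omega>) B = of_nat k} =
               exp (- measure \<mu> B) * measure \<mu> B ^ k / fact k)) \<and>
     (\<forall>B\<in>sets \<mu>. emeasure \<mu> B = \<infinity> \<longrightarrow> (AE \<omega> in \<Omega>. emeasure (\<eta> \<omega>) B = \<infinity>)) \<and>
     (\<forall>(B :: nat \<Rightarrow> 'x set) m.
        (\<forall>i<m. B i \<in> sets \<mu>) \<and> disjoint_family_on B {..<m} \<longrightarrow>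
        prob_space.indep_vars \<Omega> (\<lambda>_. borel) (\<lambda>i \<omega>. emeasure (\<eta> \<omega>) (B i)) {..<m})"

text \<open>
  \<open>\<eta> = \<Sum>\<^sub>n \<delta>\<^bsub>X n\<^esub>\<close> almost surely: the image of the counting measure under \<open>n \<mapsto> X n \<omega>\<close> gives a
  set \<open>B\<close> the mass \<open>card {n. X n \<omega> \<in> B}\<close>. All natural numbers occur as indices because the
  processes considered here have almost surely infinitely many points.
\<close>

definition enumerates_points ::
    "'w measure \<Rightarrow> ('w \<Rightarrow> 'x::topological_space measure) \<Rightarrow> (nat \<Rightarrow> 'w \<Rightarrow> 'x) \<Rightarrow> bool" where
  "enumerates_points \<Omega> \<eta> X \<longleftrightarrow>
     (\<forall>n. X n \<in> measurable \<Omega> borel) \<and>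
     (AE \<omega> in \<Omega>. \<eta> \<omega> = distr (count_space UNIV) borel (\<lambda>n. X n \<omega>))"


section \<open>The random connection model\<close>

text \<open>
  Edges are drawn by means of marks \<open>U e\<close>, one for each unordered pair \<open>e = {m, n}\<close> of distinct
  indices, which are independent, uniformly distributed on \<open>[0, 1]\<close> and independent of the points:
  the points with indices \<open>m\<close> and \<open>n\<close> are joined iff \<open>U {m, n}\<close> is at most the connection
  probability. The equation of joint laws below expresses both independence statements.
\<close>

definition index_pairs :: "nat set set" where
  "index_pairs = {e. card e = 2}"

definition edge_marks ::
    "'w measure \<Rightarrow> (nat \<Rightarrow> 'w \<Rightarrow> 'x::topological_space) \<Rightarrow> (nat set \<Rightarrow> 'w \<Rightarrow> real) \<Rightarrow> bool" where
  "edge_marks \<Omega> X U \<longleftrightarrow>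
     (\<forall>e\<in>index_pairs. U e \<in> borel_measurable \<Omega>) \<and>
     distr \<Omega> ((\<Pi>\<^sub>M n\<in>UNIV. borel) \<Otimes>\<^sub>M (\<Pi>\<^sub>M e\<in>index_pairs. borel))
         (\<lambda>\<omega>. (\<lambda>n. X n \<omega>, \<lambda>e\<in>index_pairs. U e \<omega>)) =
       distr \<Omega> (\<Pi>\<^sub>M n\<in>UNIV. borel) (\<lambda>\<omega> n. X n \<omega>) \<Otimes>\<^sub>M
       (\<Pi>\<^sub>M e\<in>index_pairs. uniform_measure lborel {0..1})"

text \<open>A graph is a pair of a vertex set and a symmetric, irreflexive adjacency relation.\<close>

type_synonym 'x graph = "'x set \<times> ('x \<times> 'x) set"

definition rcm_graph ::
    "('x \<Rightarrow> 'x \<Rightarrow> real) \<Rightarrow> (nat \<Rightarrow> 'x) \<Rightarrow> (nat set \<Rightarrow> real) \<Rightarrow> 'x graph" where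
  "rcm_graph \<phi> y u =
     (range y, {(y m, y n) |m n. y m \<noteq> y n \<and> u {m, n} \<le> \<phi> (y m) (y n)})"

definition path_connected_in :: "'x graph \<Rightarrow> 'x \<Rightarrow> 'x \<Rightarrow> bool" where
  "path_connected_in G z w \<longleftrightarrow> z \<in> fst G \<and> w \<in> fst G \<and> (z, w) \<in> (snd G)\<^sup>*"

text \<open>
  \<open>rcm \<phi> Y U\<close> is the random connection model based on the point process \<open>\<Sum>\<^sub>n \<delta>\<^bsub>Y n\<^esub>\<close>. Hence \<open>\<xi>\<close> is
  \<open>rcm \<phi> X U\<close>, where \<open>X\<close> enumerates the points of the Poisson process \<open>\<eta>\<close>, and the model based on
  $\eta + \delta_{z_1} + \delta_{z_2}$ is \<open>rcm \<phi> (add_two_points z\<^sub>1 z\<^sub>2 X) U\<close>, with the points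
  enumerated as $z_1, z_2, X_0, X_1, \ldots$ Both may use the same marks, since \<open>U\<close> is
  independent of \<open>X\<close> and only the law of each single model matters.
\<close>

definition rcm ::
    "('x \<Rightarrow> 'x \<Rightarrow> real) \<Rightarrow> (nat \<Rightarrow> 'w \<Rightarrow> 'x) \<Rightarrow> (nat set \<Rightarrow> 'w \<Rightarrow> real) \<Rightarrow> 'w \<Rightarrow> 'x graph" where
  "rcm \<phi> Y U \<omega> = rcm_graph \<phi> (\<lambda>n. Y n \<omega>) (\<lambda>e. U e \<omega>)"

definition add_two_points :: "'x \<Rightarrow> 'x \<Rightarrow> (nat \<Rightarrow> 'w \<Rightarrow> 'x) \<Rightarrow> nat \<Rightarrow> 'w \<Rightarrow> 'x" where
  "add_two_points z\<^sub>1 z\<^sub>2 X = case_nat (\<lambda>_. z\<^sub>1) (case_nat (\<lambda>_. z\<^sub>2) X)"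

text \<open>
  Irreducibility of \<open>\<xi> = rcm \<phi> X U\<close> involves the models with two added points, so it is stated for
  the data \<open>\<phi>, X, U\<close>; \<open>L\<close> is the reference measure \<open>\<lambda>\<close> on the space of marked points.
\<close>

definition rcm_irreducible ::
    "'w measure \<Rightarrow> 'x measure \<Rightarrow> ('x \<Rightarrow> 'x \<Rightarrow> real) \<Rightarrow> (nat \<Rightarrow> 'w \<Rightarrow> 'x)
      \<Rightarrow> (nat set \<Rightarrow> 'w \<Rightarrow> real) \<Rightarrow> bool" where
  "rcm_irreducible \<Omega> L \<phi> X U \<longleftrightarrow>
     (AE (z\<^sub>1, z\<^sub>2) in L \<Otimes>\<^sub>M L.
        measure \<Omega> {\<omega>\<in>space \<Omega>.
          path_connected_in (rcm \<phi> (add_two_points z\<^sub>1 z\<^sub>2 X) U \<omega>) z\<^sub>1 z\<^sub>2} > 0)"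

end

theory Submission
  imports Defs
begin

text \<open>
  Whether two points are connected with positive probability depends on \<open>\<phi>\<close> only through the relation
  \<open>\<phi> z w > 0\<close>. The proof consists of a deterministic part on this relation and of a probabilistic part
  that realises its chains by points of the Poisson process.

  Deterministic part. Call a set \<open>C\<close> of marked points invariant if almost no edge leads from \<open>C\<close> to its
  complement. It is shown that an invariant set is null or conull. Fix marks \<open>q\<close> and \<open>r\<close> that are
  joined by a set \<open>S\<close> of displacements of positive measure. Moving from \<open>q\<close> to \<open>r\<close> along one element
  of \<open>S\<close> and back along another shows that the section \<open>C\<^sub>q\<close> has all differences of elements of \<open>S\<close>
  as periods; by the theorem of Steinhaus the periods contain a ball, hence they are all of
  \<open>\<real>\<^sup>d\<close>, and \<open>C\<^sub>q\<close> is null or conull (\<open>edge_invariant_sections_null_or_conull\<close>). This reduces the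
  claim to invariant sets \<open>E\<close> of marks. Here the hypotheses enter: a typical mark \<open>q\<close> of \<open>A\<close> lying
  in \<open>E\<close> has no neighbours outside \<open>E\<close>, and since \<open>d\<^sub>\<phi>(p, q) \<ge> d\<^sub>\<phi>(p, p\<^sub>0)\<close>, neither has \<open>p\<^sub>0\<close>; so the
  marks that \<open>p\<^sub>0\<close> reaches, which are almost all, lie in \<open>E\<close> (\<open>mark_invariant_conull_if_meets_A\<close>). If
  \<open>A\<close> does not meet \<open>E\<close>, the same argument applies to the complement. The set of points reachable from
  \<open>z\<close> is invariant, and for almost every \<open>z\<close> it is not null; so it is conull, which means that for
  almost all pairs some iterated kernel is positive (\<open>AE_AE_conn_iter_pos\<close>).

  Probabilistic part. The iterated kernel of order \<open>k + 1\<close> is the integral of the weight of chains with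
  \<open>k\<close> intermediate points over the \<open>k\<close>-fold product of the intensity. On boxes with disjoint sides that
  product is the intensity of the \<open>k\<close>-tuples of points of the process, by independence of the counts;
  and such boxes cover almost everything because the intensity is diffuse
  (\<open>points_hit_nonnull_functions\<close>). Therefore some tuple of points forms, with positive probability, a
  chain of positive weight. All marks along this chain are small with positive probability,
  independently of the points, and then the chain is a path (\<open>path_connected_pos_if_chain\<close>).
\<close>

section \<open>Translations of Lebesgue measure\<close>

lemma AE_lborel_translate:
  fixes h :: "'a::euclidean_space"
  assumes "AE x in lborel. P x"
  shows "AE x in lborel. P (x + h)"
proof -
  have "AE x in distr lborel borel ((+) h). P x"
    using assms unfolding lborel_distr_plus .
  from AE_distrD[OF _ this] have "AE x in lborel. P (h + x)"
    by simp
  then show ?thesis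
    by (simp add: add.commute)
qed

lemma lborel_distr_reflect: "distr lborel borel (\<lambda>x. - x :: 'a::euclidean_space) = lborel"
  by (subst (2) lborel_affine[of "-1" 0]) (auto simp: density_1)

lemma nn_integral_lborel_translate:
  fixes h :: "'a::euclidean_space"
  assumes [measurable]: "f \<in> borel_measurable borel"
  shows "(\<integral>\<^sup>+ x. f (x + h) \<partial>lborel) = (\<integral>\<^sup>+ x. f x \<partial>lborel)"
proof -
  have "(\<integral>\<^sup>+ x. f x \<partial>lborel) = (\<integral>\<^sup>+ x. f x \<partial>distr lborel borel ((+) h))"
    by (simp add: lborel_distr_plus)
  also have "\<dots> = (\<integral>\<^sup>+ x. f (h + x) \<partial>lborel)"
    by (rule nn_integral_distr) auto
  finally show ?thesis
    by (simp add: add.commute)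
qed

lemma nn_integral_lborel_reflect:
  assumes [measurable]: "f \<in> borel_measurable borel"
  shows "(\<integral>\<^sup>+ x. f (- x :: 'a::euclidean_space) \<partial>lborel) = (\<integral>\<^sup>+ x. f x \<partial>lborel)"
proof -
  have "(\<integral>\<^sup>+ x. f x \<partial>lborel) = (\<integral>\<^sup>+ x. f x \<partial>distr lborel borel (\<lambda>x. - x :: 'a))"
    by (simp add: lborel_distr_reflect)
  also have "\<dots> = (\<integral>\<^sup>+ x. f (- x) \<partial>lborel)"
    by (rule nn_integral_distr) auto
  finally show ?thesis ..
qed

text \<open>
  Up to an error below the measure of \<open>S\<close> in a large ball, the complement of \<open>S\<close> fills an open set;
  removing that open set from the ball leaves the compact set.
\<close>

lemma positive_measure_contains_compact:
  fixes S :: "'a::euclidean_space set"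
  assumes S[measurable]: "S \<in> sets borel" and pos: "emeasure lborel S > 0"
  obtains K where "compact K" "K \<subseteq> S" "emeasure lborel K > 0"
proof -
  have "\<exists>n. emeasure lborel (S \<inter> cball 0 (real n)) \<noteq> 0"
  proof (rule ccontr)
    assume "\<not> ?thesis"
    then have "(\<Union>n. S \<inter> cball 0 (real n)) \<in> null_sets lborel"
      by (intro null_sets_UN) (auto simp: null_sets_def)
    moreover have "(\<Union>n. S \<inter> cball 0 (real n)) = S"
      using real_arch_simple by fastforce
    ultimately show False
      using pos by auto
  qed
  then obtain n where n: "emeasure lborel (S \<inter> cball 0 (real n)) > 0"
    by (auto simp: zero_less_iff_neq_zero)
  obtain e where e: "0 < e" "ennreal e < emeasure lborel (S \<inter> cball 0 (real n))"
    using n by (metis dense ennreal_cases ennreal_less_zero_iff order_less_imp_not_less top.not_eq_extremum)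
  obtain W where W: "open W" "- S \<subseteq> W" "emeasure lborel (W - (- S)) < ennreal e"
    using outer_regular_lborel[of "- S" e] e(1) by auto
  let ?K = "cball 0 (real n) - W"
  show thesis
  proof
    show "compact ?K"
      by (intro compact_diff W) auto
    show "?K \<subseteq> S"
      using W by auto
    have "S \<inter> cball 0 (real n) \<subseteq> ?K \<union> (W - (- S))"
      by auto
    then have "emeasure lborel (S \<inter> cball 0 (real n)) \<le> emeasure lborel (?K \<union> (W - (- S)))"
      using W(1) by (intro emeasure_mono) auto
    also have "\<dots> \<le> emeasure lborel ?K + emeasure lborel (W - (- S))"
      using W(1) by (intro emeasure_subadditive) auto
    finally have "emeasure lborel (S \<inter> cball 0 (real n)) \<le>
        emeasure lborel ?K + emeasure lborel (W - (- S))" .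
    then show "emeasure lborel ?K > 0"
      using W(3) e(2) by (metis add_0 leD less_trans not_gr_zero)
  qed
qed

text \<open>
  Steinhaus: a compact set \<open>K\<close> of positive measure has an open neighbourhood \<open>W\<close> of less than twice
  its measure. If \<open>h\<close> is so short that \<open>K + h \<subseteq> W\<close>, then \<open>K\<close> and \<open>K + h\<close> cannot be disjoint.
\<close>

lemma difference_set_contains_ball:
  fixes S :: "'a::euclidean_space set"
  assumes S: "S \<in> sets borel" "emeasure lborel S > 0"
  obtains r where "r > 0" "\<And>h. norm h < r \<Longrightarrow> \<exists>s\<in>S. s + h \<in> S"
proof -
  obtain K where K: "compact K" "K \<subseteq> S" "emeasure lborel K > 0"
    using positive_measure_contains_compact S by blast
  have [measurable]: "K \<in> sets borel"
    using K(1) by (simp add: borel_compact)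
  have fin: "emeasure lborel K < \<infinity>"
    using K(1) by (intro emeasure_bounded_finite compact_imp_bounded)
  obtain e where e: "0 < e" "emeasure lborel K = ennreal e"
    using K(3) fin by (cases "emeasure lborel K") auto
  obtain W where W: "open W" "K \<subseteq> W" "emeasure lborel (W - K) < ennreal e"
    using outer_regular_lborel[of K e] e(1) by auto
  have [measurable]: "W \<in> sets borel"
    using W(1) by auto
  obtain r where r: "r > 0" "(\<Union>x\<in>K. ball x r) \<subseteq> W"
    using compact_subset_open_imp_ball_epsilon_subset[OF K(1) W(1,2)] by blast
  show thesis
  proof
    show "r > 0" by fact
    fix h :: 'a assume h: "norm h < r"
    show "\<exists>s\<in>S. s + h \<in> S"
    proof (rule ccontr)
      assume *: "\<not> ?thesis"
      let ?Kh = "(+) h ` K"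
      have [measurable]: "?Kh \<in> sets borel"
        by (intro borel_compact compact_translation K(1))
      have "emeasure lborel ?Kh = emeasure lborel K"
      proof -
        have "emeasure lborel ?Kh = (\<integral>\<^sup>+ x. indicator ?Kh (x + h) \<partial>lborel)"
          by (subst nn_integral_lborel_translate) auto
        also have "\<dots> = (\<integral>\<^sup>+ x. indicator K x \<partial>lborel)"
          by (intro nn_integral_cong) (auto simp: indicator_def add.commute)
        finally show ?thesis by simp
      qed
      moreover have "?Kh \<subseteq> W - K"
      proof -
        have "x + h \<in> W" if "x \<in> K" for x
          using r that h by (force simp: dist_norm)
        then show ?thesis
          using * K(2) by (auto simp: add.commute)
      qed
      then have "emeasure lborel ?Kh \<le> emeasure lborel (W - K)"
        by (intro emeasure_mono) auto
      ultimately show False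
        using W(3) e(2) by auto
    qed
  qed
qed

text \<open>
  The periods of \<open>D\<close> form a group. By Steinhaus it contains a ball if it contains all differences
  of a set of positive measure, and so it is all of the space. By Fubini a set with all
  translations as periods is null or conull.
\<close>

lemma null_or_conull_if_AE_periods:
  fixes D :: "'a::euclidean_space set"
  assumes D[measurable]: "D \<in> sets borel"
    and S: "S \<in> sets borel" "emeasure lborel S > 0"
    and per: "\<And>s s'. s \<in> S \<Longrightarrow> s' \<in> S \<Longrightarrow> AE x in lborel. x \<in> D \<longleftrightarrow> x + (s' - s) \<in> D"
  shows "(AE x in lborel. x \<in> D) \<or> (AE x in lborel. x \<notin> D)"
proof -
  define period where "period h \<longleftrightarrow> (AE x in lborel. x \<in> D \<longleftrightarrow> x + h \<in> D)" for h
  have period_add: "period (h + k)" if "period h" "period k" for h k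
  proof -
    have "AE x in lborel. x + h \<in> D \<longleftrightarrow> (x + h) + k \<in> D"
      using that(2) AE_lborel_translate unfolding period_def by blast
    then show ?thesis
      using that(1) unfolding period_def by eventually_elim (simp add: add.assoc)
  qed
  obtain r where r: "r > 0" "\<And>h. norm h < r \<Longrightarrow> \<exists>s\<in>S. s + h \<in> S"
    using difference_set_contains_ball S by blast
  have small: "period h" if "norm h < r" for h
  proof -
    from r(2)[OF that] obtain s where "s \<in> S" "s + h \<in> S" by blast
    from per[OF this] show ?thesis
      by (simp add: period_def)
  qed
  have multiple: "period (real n *\<^sub>R h)" if "norm h < r" for n h
  proof (induction n)
    case 0
    then show ?case by (simp add: period_def)
  next
    case (Suc n)
    from period_add[OF Suc small[OF that]] show ?case
      by (simp add: algebra_simps)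
  qed
  have all: "period h" for h
  proof -
    obtain n :: nat where n: "norm h / r < real n"
      using reals_Archimedean2 by blast
    have "n > 0"
      using n r(1) by (metis divide_nonneg_pos gr0I leD norm_ge_zero of_nat_0)
    then have "norm ((1 / real n) *\<^sub>R h) < r"
      using n r(1) by (simp add: field_simps)
    from multiple[OF this, of n] show ?thesis
      using \<open>n > 0\<close> by simp
  qed
  then have "AE h in lborel. AE x in lborel. x \<in> D \<longleftrightarrow> x + h \<in> D"
    by (simp add: period_def)
  moreover have "{p \<in> space (lborel \<Otimes>\<^sub>M lborel). fst p \<in> D \<longleftrightarrow> fst p + snd p \<in> D}
      \<in> sets (lborel \<Otimes>\<^sub>M lborel)"
    by measurable
  ultimately have *: "AE x in lborel. AE h in lborel. x \<in> D \<longleftrightarrow> x + h \<in> D"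
    using lborel_pair.AE_commute[of "\<lambda>x h. x \<in> D \<longleftrightarrow> x + h \<in> D"] by blast
  show ?thesis
  proof (cases "AE x in lborel. x \<notin> D")
    case False
    have "\<exists>x. x \<in> D \<and> (AE h in lborel. x \<in> D \<longleftrightarrow> x + h \<in> D)"
    proof (rule ccontr)
      assume "\<not> ?thesis"
      with * have "AE x in lborel. x \<notin> D"
        by (auto elim!: eventually_mono)
      with False show False ..
    qed
    then obtain x where "x \<in> D" "AE h in lborel. x \<in> D \<longleftrightarrow> x + h \<in> D"
      by auto
    then have "AE h in lborel. x + h \<in> D" by auto
    from AE_lborel_translate[OF this, of "- x"] show ?thesis
      by (simp add: algebra_simps)
  qed auto
qed


section \<open>Scaling a measure\<close>

lemma scale_measure_eq_density: "scale_measure c M = density M (\<lambda>_. c)"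
  by (intro measure_eqI) (simp_all add: emeasure_density_const)

lemma AE_scale_measure_iff:
  assumes "t > 0"
  shows "(AE x in scale_measure (ennreal t) M. P x) \<longleftrightarrow> (AE x in M. P x)"
  unfolding scale_measure_eq_density using assms by (subst AE_density) auto

lemma sigma_finite_scale_measure:
  assumes "sigma_finite_measure M"
  shows "sigma_finite_measure (scale_measure (ennreal t) M)"
  unfolding scale_measure_eq_density
  using sigma_finite_measure.sigma_finite_iff_density_finite[OF assms, of "\<lambda>_. ennreal t"]
  by simp


section \<open>Relations between marked points\<close>

locale mark_space = prob_space Q for Q :: "'m::polish_space measure" +
  assumes sets_Q [measurable_cong]: "sets Q = sets borel"
begin

lemma space_Q [simp]: "space Q = UNIV"
  using sets_eq_imp_space_eq[OF sets_Q] by simp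

lemma sets_marked_lebesgue [measurable_cong]:
  "sets (marked_lebesgue Q :: ('a::euclidean_space \<times> 'm) measure) = sets borel"
proof -
  have "sets (marked_lebesgue Q :: ('a \<times> 'm) measure) = sets (borel \<Otimes>\<^sub>M borel)"
    unfolding marked_lebesgue_def by (intro sets_pair_measure_cong) (simp_all add: sets_Q)
  then show ?thesis
    by (simp only: borel_prod)
qed

lemma space_marked_lebesgue [simp]: "space (marked_lebesgue Q) = UNIV"
  by (simp add: marked_lebesgue_def space_pair_measure)

lemma pair_sigma_finite_lborel_Q: "pair_sigma_finite (lborel :: 'a::euclidean_space measure) Q"
  by (intro pair_sigma_finite.intro sigma_finite_lborel sigma_finite_measure_axioms)

lemma sigma_finite_marked_lebesgue:
  "sigma_finite_measure (marked_lebesgue Q :: ('a::euclidean_space \<times> 'm) measure)"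
proof -
  interpret pair_sigma_finite "lborel :: 'a measure" Q
    by (rule pair_sigma_finite_lborel_Q)
  show ?thesis
    unfolding marked_lebesgue_def by (rule sigma_finite_measure_axioms)
qed

lemma nn_integral_marked_lebesgue:
  assumes [measurable]: "f \<in> borel_measurable (borel :: ('a::euclidean_space \<times> 'm) measure)"
  shows "(\<integral>\<^sup>+ z. f z \<partial>marked_lebesgue Q) = (\<integral>\<^sup>+ q. \<integral>\<^sup>+ x. f (x, q) \<partial>lborel \<partial>Q)"
proof -
  interpret pair_sigma_finite "lborel :: 'a measure" Q
    by (rule pair_sigma_finite_lborel_Q)
  have "f \<in> borel_measurable (marked_lebesgue Q)"
    by measurable
  then show ?thesis
    unfolding marked_lebesgue_def using nn_integral_snd[of f] by simp
qed

lemma AE_marked_lebesgue: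
  fixes P :: "'a::euclidean_space \<times> 'm \<Rightarrow> bool"
  assumes [measurable]: "Measurable.pred borel P"
  shows "(AE z in marked_lebesgue Q. P z) \<longleftrightarrow> (AE q in Q. AE x in lborel. P (x, q))"
proof -
  have "(AE z in marked_lebesgue Q. P z) \<longleftrightarrow>
      (\<integral>\<^sup>+ z. indicator {z. \<not> P z} z \<partial>marked_lebesgue Q) = 0"
    by (subst nn_integral_0_iff_AE) (auto simp: indicator_def)
  also have "\<dots> \<longleftrightarrow> (AE q in Q. AE x in lborel. P (x, q))"
    by (subst nn_integral_marked_lebesgue)
       (auto simp: indicator_def nn_integral_0_iff_AE)
  finally show ?thesis .
qed

text \<open>
  A pair of marked points is described by its two marks, the displacement \<open>s\<close> between the locations and
  the location \<open>x\<close> of the first point. By stationarity a connection probability depends on \<open>(q, r, s)\<close>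
  only, so that for fixed \<open>(q, r, s)\<close> the variable \<open>x\<close> is free; this is what turns statements about
  edges into statements about translates of sets.
\<close>

lemma nn_integral_displacement:
  assumes [measurable]: "F \<in> borel_measurable
    ((borel :: ('a::euclidean_space \<times> 'm) measure) \<Otimes>\<^sub>M (borel :: ('a \<times> 'm) measure))"
  shows "(\<integral>\<^sup>+ w. \<integral>\<^sup>+ z. F (z, w) \<partial>marked_lebesgue Q \<partial>marked_lebesgue Q) =
    (\<integral>\<^sup>+ (q, r). (\<integral>\<^sup>+ s. \<integral>\<^sup>+ x. F ((x, q), (x + s, r)) \<partial>lborel \<partial>lborel) \<partial>(Q \<Otimes>\<^sub>M Q))"
proof -
  interpret LQ: pair_sigma_finite "lborel :: 'a measure" Q
    by (rule pair_sigma_finite_lborel_Q)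
  interpret QQ: pair_sigma_finite Q Q ..
  interpret L: sigma_finite_measure "marked_lebesgue Q :: ('a \<times> 'm) measure"
    by (rule sigma_finite_marked_lebesgue)
  have "(\<integral>\<^sup>+ w. \<integral>\<^sup>+ z. F (z, w) \<partial>marked_lebesgue Q \<partial>marked_lebesgue Q) =
      (\<integral>\<^sup>+ r. \<integral>\<^sup>+ y. \<integral>\<^sup>+ z. F (z, (y, r)) \<partial>marked_lebesgue Q \<partial>lborel \<partial>Q)"
    by (rule nn_integral_marked_lebesgue) measurable
  also have "\<dots> = (\<integral>\<^sup>+ r. \<integral>\<^sup>+ y. \<integral>\<^sup>+ q. \<integral>\<^sup>+ x. F ((x, q), (y, r)) \<partial>lborel \<partial>Q \<partial>lborel \<partial>Q)"
    by (intro nn_integral_cong nn_integral_marked_lebesgue) measurable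
  also have "\<dots> = (\<integral>\<^sup>+ r. \<integral>\<^sup>+ q. \<integral>\<^sup>+ y. \<integral>\<^sup>+ x. F ((x, q), (y, r)) \<partial>lborel \<partial>lborel \<partial>Q \<partial>Q)"
    by (intro nn_integral_cong LQ.Fubini'[symmetric]) measurable
  also have "\<dots> = (\<integral>\<^sup>+ r. \<integral>\<^sup>+ q. \<integral>\<^sup>+ x. \<integral>\<^sup>+ y. F ((x, q), (y, r)) \<partial>lborel \<partial>lborel \<partial>Q \<partial>Q)"
    by (intro nn_integral_cong lborel_pair.Fubini') measurable
  also have "\<dots> = (\<integral>\<^sup>+ r. \<integral>\<^sup>+ q. \<integral>\<^sup>+ x. \<integral>\<^sup>+ s. F ((x, q), (s + x, r)) \<partial>lborel \<partial>lborel \<partial>Q \<partial>Q)"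
    by (intro nn_integral_cong nn_integral_lborel_translate[symmetric]) measurable
  also have "\<dots> = (\<integral>\<^sup>+ r. \<integral>\<^sup>+ q. \<integral>\<^sup>+ s. \<integral>\<^sup>+ x. F ((x, q), (x + s, r)) \<partial>lborel \<partial>lborel \<partial>Q \<partial>Q)"
    by (subst (2) add.commute, intro nn_integral_cong lborel_pair.Fubini') measurable
  also have "\<dots> = (\<integral>\<^sup>+ (q, r). (\<integral>\<^sup>+ s. \<integral>\<^sup>+ x. F ((x, q), (x + s, r)) \<partial>lborel \<partial>lborel) \<partial>(Q \<Otimes>\<^sub>M Q))"
    by (subst QQ.nn_integral_snd[symmetric]) (simp_all, measurable)
  finally show ?thesis .
qed

lemma AE_displacement:
  fixes R :: "'a::euclidean_space \<times> 'm \<Rightarrow> 'a \<times> 'm \<Rightarrow> bool"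
  assumes [measurable]: "Measurable.pred (borel \<Otimes>\<^sub>M borel) (\<lambda>p. R (fst p) (snd p))"
  shows "(AE w in marked_lebesgue Q. AE z in marked_lebesgue Q. R z w) \<longleftrightarrow>
    (AE (q, r) in Q \<Otimes>\<^sub>M Q. AE s in lborel. AE x in lborel. R (x, q) (x + s, r))"
proof -
  interpret L: sigma_finite_measure "marked_lebesgue Q :: ('a \<times> 'm) measure"
    by (rule sigma_finite_marked_lebesgue)
  define F :: "('a \<times> 'm) \<times> ('a \<times> 'm) \<Rightarrow> ennreal"
    where "F = indicator {p. \<not> R (fst p) (snd p)}"
  have [measurable]: "F \<in> borel_measurable (borel \<Otimes>\<^sub>M borel)"
    unfolding F_def by measurable
  have F: "F (z, w) = 0 \<longleftrightarrow> R z w" for z w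
    by (simp add: F_def indicator_def)
  have "(AE w in marked_lebesgue Q. AE z in marked_lebesgue Q. R z w) \<longleftrightarrow>
      (\<integral>\<^sup>+ w. \<integral>\<^sup>+ z. F (z, w) \<partial>marked_lebesgue Q \<partial>marked_lebesgue Q) = 0"
    by (simp add: nn_integral_0_iff_AE F)
  also have "\<dots> \<longleftrightarrow>
      (\<integral>\<^sup>+ (q, r). (\<integral>\<^sup>+ s. \<integral>\<^sup>+ x. F ((x, q), (x + s, r)) \<partial>lborel \<partial>lborel) \<partial>(Q \<Otimes>\<^sub>M Q)) = 0"
    by (simp add: nn_integral_displacement)
  also have "\<dots> \<longleftrightarrow>
      (AE (q, r) in Q \<Otimes>\<^sub>M Q. AE s in lborel. AE x in lborel. R (x, q) (x + s, r))"
    by (simp add: nn_integral_0_iff_AE F split_beta')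
  finally show ?thesis .
qed

end

locale connection_model = mark_space Q for Q :: "'m::polish_space measure" +
  fixes \<phi> :: "'a::euclidean_space \<times> 'm \<Rightarrow> 'a \<times> 'm \<Rightarrow> real"
  assumes connection_function: "stationary_connection_function Q \<phi>"
begin

abbreviation "L \<equiv> marked_lebesgue Q :: ('a \<times> 'm) measure"

sublocale L: sigma_finite_measure L
  by (rule sigma_finite_marked_lebesgue)

sublocale QQ: pair_sigma_finite Q Q ..

sublocale LL: pair_sigma_finite L L ..

lemma phi_measurable [measurable (raw)]:
  assumes "f \<in> borel_measurable M" "g \<in> borel_measurable M"
  shows "(\<lambda>x. \<phi> (f x) (g x)) \<in> borel_measurable M"
proof -
  have "(\<lambda>(z, w). \<phi> z w) \<in> borel_measurable (borel \<Otimes>\<^sub>M borel)"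
    using connection_function by (simp add: stationary_connection_function_def)
  from measurable_compose[OF measurable_Pair[OF assms] this] show ?thesis
    by simp
qed

lemma phi_nonneg [simp]: "0 \<le> \<phi> z w"
  using connection_function unfolding stationary_connection_function_def by blast

lemma phi_sym: "\<phi> z w = \<phi> w z"
  using connection_function unfolding stationary_connection_function_def by blast

lemma phi_stationary: "\<phi> (x, p) (y, q) = \<phi> (0, p) (y - x, q)"
  using connection_function unfolding stationary_connection_function_def by blast

abbreviation degree :: "'m \<Rightarrow> 'm \<Rightarrow> ennreal" where
  "degree \<equiv> conn_degree Q \<phi> (Suc 0)"

lemma degree_eq: "degree p q = (\<integral>\<^sup>+ x. ennreal (\<phi> (0, p) (x, q)) \<partial>lborel)"
  by (simp add: conn_degree_def)

lemma degree_measurable [measurable (raw)]: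
  assumes [measurable]: "f \<in> borel_measurable M" "g \<in> borel_measurable M"
  shows "(\<lambda>x. degree (f x) (g x)) \<in> borel_measurable M"
  unfolding degree_eq by measurable

lemma degree_sym: "degree p q = degree q p"
proof -
  have "degree p q = (\<integral>\<^sup>+ x. ennreal (\<phi> (0, q) (- x, p)) \<partial>lborel)"
    unfolding degree_eq by (subst phi_sym, subst phi_stationary) simp
  also have "\<dots> = degree q p"
    unfolding degree_eq by (rule nn_integral_lborel_reflect[of "\<lambda>x. ennreal (\<phi> (0, q) (x, p))"]) measurable
  finally show ?thesis .
qed

lemma degree_eq_0_iff: "degree p q = 0 \<longleftrightarrow> (AE x in lborel. \<not> 0 < \<phi> (0, p) (x, q))"
  unfolding degree_eq by (subst nn_integral_0_iff_AE) (simp_all add: ennreal_eq_0_iff not_less)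


section \<open>Edge-invariant sets of marked points\<close>

text \<open>
  Up to null sets, such a set behaves like a union of components of the graph in which two marked
  points are adjacent whenever their connection probability is positive. The second notion is the analogue
  for the marks alone, where two marks are adjacent whenever some displacement connects them with
  positive probability.
\<close>

definition edge_invariant :: "('a \<times> 'm) set \<Rightarrow> bool" where
  "edge_invariant C \<longleftrightarrow> (AE w in L. AE z in L. 0 < \<phi> z w \<longrightarrow> (z \<in> C \<longleftrightarrow> w \<in> C))"

definition mark_invariant :: "'m set \<Rightarrow> bool" where
  "mark_invariant E \<longleftrightarrow> (AE (q, r) in Q \<Otimes>\<^sub>M Q. degree q r \<noteq> 0 \<longrightarrow> (q \<in> E \<longleftrightarrow> r \<in> E))"

text \<open>
  Let \<open>C\<^sub>q\<close> be the section of \<open>C\<close> at the mark \<open>q\<close>. For almost every displacement \<open>s\<close> that can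
  connect the marks \<open>q\<close> and \<open>r\<close>, the sets \<open>C\<^sub>q + s\<close> and \<open>C\<^sub>r\<close> agree up to a null set. Hence the
  differences of two such displacements are periods of \<open>C\<^sub>q\<close>, and as these displacements form a set
  of positive measure, \<open>C\<^sub>q\<close> is null or conull. Its translate \<open>C\<^sub>r\<close> is then of the same kind.
\<close>

lemma edge_invariant_sections_null_or_conull:
  assumes [measurable]: "C \<in> sets borel" and C: "edge_invariant C"
  shows "AE (q, r) in Q \<Otimes>\<^sub>M Q. degree q r \<noteq> 0 \<longrightarrow>
    (AE x in lborel. (x, q) \<in> C) \<and> (AE x in lborel. (x, r) \<in> C) \<or>
    (AE x in lborel. (x, q) \<notin> C) \<and> (AE x in lborel. (x, r) \<notin> C)"
proof -
  have "AE (q, r) in Q \<Otimes>\<^sub>M Q. AE s in lborel. AE x in lborel.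
      0 < \<phi> (x, q) (x + s, r) \<longrightarrow> ((x, q) \<in> C \<longleftrightarrow> (x + s, r) \<in> C)"
    using C unfolding edge_invariant_def
    by (subst (asm) AE_displacement) measurable
  then show ?thesis
  proof (rule eventually_mono, simp only: split_paired_all prod.case, intro impI)
    fix q r
    assume d: "degree q r \<noteq> 0"
    assume "AE s in lborel. AE x in lborel. 0 < \<phi> (x, q) (x + s, r) \<longrightarrow>
      ((x, q) \<in> C) = ((x + s, r) \<in> C)"
    then have "AE s in lborel. AE x in lborel. 0 < \<phi> (0, q) (s, r) \<longrightarrow>
      ((x, q) \<in> C) = ((x + s, r) \<in> C)"
      by (simp add: phi_stationary[of _ _ "_ + _"])
    then obtain N where N: "N \<in> null_sets lborel"
      "\<And>s. s \<notin> N \<Longrightarrow> AE x in lborel. 0 < \<phi> (0, q) (s, r) \<longrightarrow> ((x, q) \<in> C) = ((x + s, r) \<in> C)"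
      by (auto elim!: AE_E3)
    \<comment> \<open>the admissible displacements, without the exceptional ones\<close>
    define S where "S = {s. 0 < \<phi> (0, q) (s, r)} - N"
    have [measurable]: "N \<in> sets borel"
      using N(1) by auto
    have S: "S \<in> sets borel"
      unfolding S_def by measurable
    have "emeasure lborel S = emeasure lborel {s. 0 < \<phi> (0, q) (s, r)}"
      unfolding S_def using N(1) by (intro emeasure_Diff_null_set) measurable
    also have "\<dots> \<noteq> 0"
      using d by (simp add: degree_eq_0_iff AE_iff_measurable[OF _ refl])
    finally have pos: "emeasure lborel S > 0"
      by (simp add: zero_less_iff_neq_zero)
    have shift: "AE x in lborel. (x, q) \<in> C \<longleftrightarrow> (x + s, r) \<in> C" if "s \<in> S" for s
      using N(2)[of s] that by (auto simp: S_def)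
    \<comment> \<open>move from \<open>q\<close> to \<open>r\<close> along \<open>s'\<close> and back along \<open>s\<close>\<close>
    have "AE x in lborel. x \<in> {x. (x, q) \<in> C} \<longleftrightarrow> x + (s' - s) \<in> {x. (x, q) \<in> C}"
      if "s \<in> S" "s' \<in> S" for s s'
      using shift[OF that(2)] AE_lborel_translate[OF shift[OF that(1)], of "s' - s"]
      by eventually_elim (simp add: algebra_simps)
    from null_or_conull_if_AE_periods[OF _ S pos this]
    have q: "(AE x in lborel. (x, q) \<in> C) \<or> (AE x in lborel. (x, q) \<notin> C)"
      by simp
    obtain s where s: "s \<in> S"
      using pos by fastforce
    have reverse: "AE x in lborel. (x - s, q) \<in> C \<longleftrightarrow> (x, r) \<in> C"
      using AE_lborel_translate[OF shift[OF s], of "- s"] by simp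
    have "(AE x in lborel. (x, r) \<in> C)" if "AE x in lborel. (x, q) \<in> C"
      using reverse AE_lborel_translate[OF that, of "- s"] by eventually_elim simp
    moreover have "(AE x in lborel. (x, r) \<notin> C)" if "AE x in lborel. (x, q) \<notin> C"
      using reverse AE_lborel_translate[OF that, of "- s"] by eventually_elim simp
    ultimately show "(AE x in lborel. (x, q) \<in> C) \<and> (AE x in lborel. (x, r) \<in> C) \<or>
      (AE x in lborel. (x, q) \<notin> C) \<and> (AE x in lborel. (x, r) \<notin> C)"
      using q by blast
  qed
qed

lemma edge_invariant_cylinder:
  assumes [measurable]: "E \<in> sets borel" and "mark_invariant E"
  shows "edge_invariant (UNIV \<times> E)"
  unfolding edge_invariant_def
proof (subst AE_displacement)
  have [measurable]: "(UNIV \<times> E :: ('a \<times> 'm) set) \<in> sets borel"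
    unfolding borel_prod[symmetric] by measurable
  show "Measurable.pred (borel \<Otimes>\<^sub>M borel)
      (\<lambda>p. 0 < \<phi> (fst p) (snd p) \<longrightarrow> (fst p \<in> UNIV \<times> E) = (snd p \<in> UNIV \<times> E))"
    by measurable
  show "AE (q, r) in Q \<Otimes>\<^sub>M Q. AE s in lborel. AE x in lborel. 0 < \<phi> (x, q) (x + s, r) \<longrightarrow>
      ((x, q) \<in> UNIV \<times> E) = ((x + s, r) \<in> UNIV \<times> E)"
    using assms(2) unfolding mark_invariant_def
  proof (rule eventually_mono, clarify)
    fix q r
    assume *: "degree q r \<noteq> 0 \<longrightarrow> (q \<in> E) = (r \<in> E)"
    show "AE s in lborel. AE x in lborel. 0 < \<phi> (x, q) (x + s, r) \<longrightarrow>
        ((x, q) \<in> UNIV \<times> E) = ((x + s, r) \<in> UNIV \<times> E)"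
    proof (cases "(q \<in> E) = (r \<in> E)")
      case False
      with * have "AE s in lborel. \<not> 0 < \<phi> (0, q) (s, r)"
        by (simp add: degree_eq_0_iff)
      then show ?thesis by eventually_elim (simp add: phi_stationary[of _ _ "_ + _"])
    qed simp
  qed
qed

end


section \<open>Irreducibility of the marks\<close>

lemma (in connection_model) conn_iter_measurable:
  assumes M: "sigma_finite_measure M" and sets_M: "sets M = sets (borel :: ('a \<times> 'm) measure)"
    and fg: "f \<in> borel_measurable N" "g \<in> borel_measurable N"
  shows "(\<lambda>x. conn_iter M \<phi> n (f x) (g x)) \<in> borel_measurable N"
proof -
  interpret sigma_finite_measure M by (rule M)
  note sets_M [measurable_cong]
  have "(\<lambda>p. conn_iter M \<phi> n (fst p) (snd p)) \<in> borel_measurable (borel \<Otimes>\<^sub>M borel)"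
  proof (induction n)
    case (Suc n)
    show ?case
    proof (cases n)
      case (Suc k)
      have [measurable]: "(\<lambda>x. conn_iter M \<phi> (Suc k) (f x) (g x)) \<in> borel_measurable N"
        if "f \<in> borel_measurable N" "g \<in> borel_measurable N"
        for N :: "((('a \<times> 'm) \<times> ('a \<times> 'm)) \<times> ('a \<times> 'm)) measure" and f g
        using measurable_compose[OF measurable_Pair[OF that] Suc.IH] Suc by simp
      show ?thesis
        unfolding Suc by (simp, measurable)
    qed simp
  qed simp
  from measurable_compose[OF measurable_Pair[OF fg] this] show ?thesis
    by simp
qed

text \<open>
  The marks in \<open>A\<close> have, with almost every mark, at least as large a degree as the root mark
  \<open>p\<^sub>0\<close> has, and the root reaches almost every mark. The root itself may form a null set of marks, so it
  cannot be used as a typical mark; typical elements of \<open>A\<close> take over its role.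
\<close>

locale dominated_connection_model = connection_model Q \<phi>
  for Q :: "'m::polish_space measure" and \<phi> :: "'a::euclidean_space \<times> 'm \<Rightarrow> 'a \<times> 'm \<Rightarrow> real" +
  fixes A :: "'m set" and p\<^sub>0 :: 'm
  assumes A: "A \<in> sets Q" "emeasure Q A > 0"
    and dominated: "AE (p, q) in Q \<Otimes>\<^sub>M Q. q \<in> A \<longrightarrow> degree p p\<^sub>0 \<le> degree p q"
    and root_reaches: "AE q in Q. (SUP n\<in>{1..}. conn_degree Q \<phi> n p\<^sub>0 q) > 0"
begin

lemma A_borel [measurable]: "A \<in> sets borel"
  using A(1) sets_Q by simp

text \<open>
  If the root has no neighbours outside \<open>E\<close>, then a walk from the root is inside \<open>E\<close> after its first
  step, and by invariance it never leaves \<open>E\<close> again.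
\<close>

lemma conn_iter_eq_0_outside:
  assumes E[measurable]: "E \<in> sets borel" and inv: "mark_invariant E"
    and root: "AE p in Q. p \<notin> E \<longrightarrow> degree p p\<^sub>0 = 0"
  shows "AE w in L. snd w \<notin> E \<longrightarrow> conn_iter L \<phi> n (0, p\<^sub>0) w = 0"
proof (induction n)
  case (Suc n)
  note [measurable] = conn_iter_measurable[OF sigma_finite_marked_lebesgue sets_marked_lebesgue]
  have [measurable]: "Measurable.pred borel (\<lambda>w :: 'a \<times> 'm. snd w \<in> E)"
    unfolding borel_prod[symmetric] by measurable
  show ?case
  proof (cases n)
    case 0
    have "AE r in Q. AE x in lborel. r \<notin> E \<longrightarrow> \<not> 0 < \<phi> (0, p\<^sub>0) (x, r)"
      using root by eventually_elim (auto simp: degree_sym[of _ p\<^sub>0] degree_eq_0_iff)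
    then show ?thesis
      unfolding 0 by (subst AE_marked_lebesgue) (simp_all add: ennreal_eq_0_iff not_less)
  next
    case (Suc k)
    have "AE w in L. AE z in L. 0 < \<phi> z w \<longrightarrow> (snd z \<in> E \<longleftrightarrow> snd w \<in> E)"
      using edge_invariant_cylinder[OF E inv] by (simp add: edge_invariant_def mem_Times_iff)
    then show ?thesis
    proof eventually_elim
      case (elim w)
      show ?case
      proof
        assume w: "snd w \<notin> E"
        have "AE z in L. conn_iter L \<phi> (Suc k) (0, p\<^sub>0) z * ennreal (\<phi> z w) = 0"
          using elim Suc.IH unfolding \<open>n = Suc k\<close>
          by eventually_elim (use w in \<open>auto simp: not_less ennreal_eq_0_iff\<close>)
        then have "(\<integral>\<^sup>+ z. conn_iter L \<phi> (Suc k) (0, p\<^sub>0) z * ennreal (\<phi> z w) \<partial>L) = (\<integral>\<^sup>+ z. 0 \<partial>L)"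
          by (rule nn_integral_cong_AE)
        then show "conn_iter L \<phi> (Suc n) (0, p\<^sub>0) w = 0"
          by (simp add: \<open>n = Suc k\<close>)
      qed
    qed
  qed
qed simp

lemma mark_invariant_conull_if_root_inside:
  assumes E[measurable]: "E \<in> sets borel" and inv: "mark_invariant E"
    and root: "AE p in Q. p \<notin> E \<longrightarrow> degree p p\<^sub>0 = 0"
  shows "AE q in Q. q \<in> E"
proof -
  note [measurable] = conn_iter_measurable[OF sigma_finite_marked_lebesgue sets_marked_lebesgue]
  have [measurable]: "Measurable.pred borel (\<lambda>w :: 'a \<times> 'm. snd w \<in> E)"
    unfolding borel_prod[symmetric] by measurable
  have "AE w in L. \<forall>n. snd w \<notin> E \<longrightarrow> conn_iter L \<phi> n (0, p\<^sub>0) w = 0"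
    unfolding AE_all_countable using conn_iter_eq_0_outside[OF assms] by blast
  then have "AE q in Q. AE x in lborel. \<forall>n. q \<notin> E \<longrightarrow> conn_iter L \<phi> n (0, p\<^sub>0) (x, q) = 0"
    by (subst (asm) AE_marked_lebesgue) simp_all
  then show ?thesis
    using root_reaches
  proof eventually_elim
    case (elim q)
    show ?case
    proof (rule ccontr)
      assume "q \<notin> E"
      have "conn_degree Q \<phi> n p\<^sub>0 q = (\<integral>\<^sup>+ x. 0 \<partial>(lborel :: 'a measure))" for n
        unfolding conn_degree_def
        by (intro nn_integral_cong_AE) (use elim(1) \<open>q \<notin> E\<close> in \<open>auto elim: eventually_mono\<close>)
      with elim(2) show False
        by simp
    qed
  qed
qed

lemma AE_dominated: "AE q in Q. AE p in Q. q \<in> A \<longrightarrow> degree p p\<^sub>0 \<le> degree p q"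
proof -
  have "AE p in Q. AE q in Q. q \<in> A \<longrightarrow> degree p p\<^sub>0 \<le> degree p q"
    using QQ.AE_pair[OF dominated] by simp
  moreover have "{x \<in> space (Q \<Otimes>\<^sub>M Q). snd x \<in> A \<longrightarrow> degree (fst x) p\<^sub>0 \<le> degree (fst x) (snd x)}
      \<in> sets (Q \<Otimes>\<^sub>M Q)"
    by measurable
  ultimately show ?thesis
    using QQ.AE_commute[of "\<lambda>p q. q \<in> A \<longrightarrow> degree p p\<^sub>0 \<le> degree p q"] by blast
qed

lemma mark_invariant_compl: "mark_invariant E \<Longrightarrow> mark_invariant (- E)"
  unfolding mark_invariant_def by (rule eventually_mono) auto

lemma AE_mark_invariant:
  assumes "mark_invariant E"
  shows "AE q in Q. AE p in Q. degree p q \<noteq> 0 \<longrightarrow> (p \<in> E \<longleftrightarrow> q \<in> E)"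
  using QQ.AE_pair[OF assms[unfolded mark_invariant_def]]
  by (auto simp: degree_sym elim!: eventually_mono)

text \<open>
  A typical \<open>q \<in> A \<inter> E\<close> has no neighbours outside \<open>E\<close>, by invariance. As \<open>q\<close> dominates the root,
  the root has none either, and so everything that it reaches lies in \<open>E\<close>.
\<close>

lemma mark_invariant_conull_if_meets_A:
  assumes [measurable]: "E \<in> sets borel" and inv: "mark_invariant E"
    and meets: "\<not> (AE q in Q. q \<in> A \<longrightarrow> q \<notin> E)"
  shows "AE q in Q. q \<in> E"
proof -
  have "\<exists>q. q \<in> A \<and> q \<in> E \<and> (AE p in Q. q \<in> A \<longrightarrow> degree p p\<^sub>0 \<le> degree p q) \<and>
      (AE p in Q. degree p q \<noteq> 0 \<longrightarrow> (p \<in> E \<longleftrightarrow> q \<in> E))"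
  proof (rule ccontr)
    assume *: "\<not> ?thesis"
    have "AE q in Q. q \<in> A \<longrightarrow> q \<notin> E"
      using AE_dominated AE_mark_invariant[OF inv] by eventually_elim (use * in blast)
    with meets show False ..
  qed
  then obtain q where q: "q \<in> A" "q \<in> E"
    "AE p in Q. q \<in> A \<longrightarrow> degree p p\<^sub>0 \<le> degree p q"
    "AE p in Q. degree p q \<noteq> 0 \<longrightarrow> (p \<in> E \<longleftrightarrow> q \<in> E)"
    by blast
  have "AE p in Q. p \<notin> E \<longrightarrow> degree p p\<^sub>0 = 0"
    using q(3,4) by eventually_elim (use q(1,2) in auto)
  then show ?thesis
    by (intro mark_invariant_conull_if_root_inside inv) measurable
qed

lemma not_AE_not_A: "\<not> (AE q in Q. q \<notin> A)"
  using A by (auto simp: AE_iff_measurable[OF A(1)])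

text \<open>
  Since \<open>A\<close> is not null, it meets \<open>E\<close> or its complement in a set of positive measure.
\<close>

lemma mark_invariant_null_or_conull:
  assumes [measurable]: "E \<in> sets borel" and inv: "mark_invariant E"
  shows "(AE q in Q. q \<in> E) \<or> (AE q in Q. q \<notin> E)"
proof (cases "AE q in Q. q \<in> A \<longrightarrow> q \<notin> E")
  case True
  have "\<not> (AE q in Q. q \<in> A \<longrightarrow> q \<notin> - E)"
  proof
    assume "AE q in Q. q \<in> A \<longrightarrow> q \<notin> - E"
    with True have "AE q in Q. q \<notin> A"
      by eventually_elim blast
    with not_AE_not_A show False ..
  qed
  from mark_invariant_conull_if_meets_A[OF _ mark_invariant_compl[OF inv] this] show ?thesis
    by simp
next
  case False
  from mark_invariant_conull_if_meets_A[OF assms this] show ?thesis ..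
qed

text \<open>
  The isolated marks form an invariant set \<open>E\<close>. If it were conull, it would contain some \<open>q \<in> A\<close>; the
  root, being dominated by \<open>q\<close>, would be isolated as well and would reach almost no mark.
\<close>

lemma degree_integral_pos: "AE q in Q. (\<integral>\<^sup>+ r. degree q r \<partial>Q) \<noteq> 0"
proof -
  define E where "E = {q. (\<integral>\<^sup>+ r. degree q r \<partial>Q) = 0}"
  have [measurable]: "E \<in> sets borel"
    unfolding E_def by measurable
  have E: "q \<in> E \<longleftrightarrow> (AE r in Q. degree q r = 0)" for q
    unfolding E_def by (simp add: nn_integral_0_iff_AE)
  have 1: "AE q in Q. AE r in Q. degree q r \<noteq> 0 \<longrightarrow> q \<notin> E"
  proof (rule AE_I2)
    fix q
    show "AE r in Q. degree q r \<noteq> 0 \<longrightarrow> q \<notin> E"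
      using E[of q] by (cases "q \<in> E") auto
  qed
  have "{x \<in> space (Q \<Otimes>\<^sub>M Q). degree (fst x) (snd x) \<noteq> 0 \<longrightarrow> fst x \<notin> E} \<in> sets (Q \<Otimes>\<^sub>M Q)"
    by measurable
  with 1 have 2: "AE r in Q. AE q in Q. degree q r \<noteq> 0 \<longrightarrow> q \<notin> E"
    using QQ.AE_commute[of "\<lambda>q r. degree q r \<noteq> 0 \<longrightarrow> q \<notin> E"] by blast
  have 3: "AE q in Q. AE r in Q. degree q r \<noteq> 0 \<longrightarrow> (q \<in> E \<longleftrightarrow> r \<in> E)"
    using 1 2
  proof eventually_elim
    case (elim q)
    then show ?case
      by eventually_elim (simp add: degree_sym)
  qed
  have "{x \<in> space (Q \<Otimes>\<^sub>M Q). case x of (q, r) \<Rightarrow> degree q r \<noteq> 0 \<longrightarrow> (q \<in> E \<longleftrightarrow> r \<in> E)}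
      \<in> sets (Q \<Otimes>\<^sub>M Q)"
    by measurable
  with 3 have "mark_invariant E"
    unfolding mark_invariant_def by (intro QQ.AE_pair_measure) simp_all
  from mark_invariant_null_or_conull[OF \<open>E \<in> sets borel\<close> this]
  consider "AE q in Q. q \<in> E" | "AE q in Q. q \<notin> E"
    by blast
  then show ?thesis
  proof cases
    case 1
    have "\<exists>q. q \<in> A \<and> q \<in> E \<and> (AE p in Q. q \<in> A \<longrightarrow> degree p p\<^sub>0 \<le> degree p q)"
    proof (rule ccontr)
      assume *: "\<not> ?thesis"
      have "AE q in Q. q \<notin> A"
        using AE_dominated 1 by eventually_elim (use * in blast)
      with not_AE_not_A show False ..
    qed
    then obtain q where q: "q \<in> A" "AE p in Q. degree q p = 0"
      "AE p in Q. q \<in> A \<longrightarrow> degree p p\<^sub>0 \<le> degree p q"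
      unfolding E by blast
    have "AE p in Q. degree p p\<^sub>0 = 0"
      using q(2,3) by eventually_elim (use q(1) in \<open>auto simp: degree_sym\<close>)
    moreover have "mark_invariant {}"
      by (simp add: mark_invariant_def)
    ultimately have "AE q in Q. q \<in> {}"
      by (intro mark_invariant_conull_if_root_inside) auto
    then show ?thesis
      by auto
  next
    case 2
    then show ?thesis
      by (simp add: E_def)
  qed
qed

subsection \<open>From marks to marked points\<close>

text \<open>
  The marks with a conull section form an invariant set of marks, which is null or conull. A mark
  whose section is not conull has a null section, because it has a neighbour.
\<close>

lemma edge_invariant_null_or_conull:
  assumes C[measurable]: "C \<in> sets borel" and inv: "edge_invariant C"
  shows "(AE z in L. z \<in> C) \<or> (AE z in L. z \<notin> C)"
proof -
  let ?full = "\<lambda>q. AE x in lborel. (x, q) \<in> C" and ?empty = "\<lambda>q. AE x in lborel. (x, q) \<notin> C"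
  have excl: False if "?full q" "?empty q" for q
  proof -
    have "AE x in (lborel :: 'a measure). False"
      using that by eventually_elim simp
    then show False
      by (simp add: AE_iff_measurable[OF _ refl])
  qed
  define E where "E = {q. (\<integral>\<^sup>+ x. indicator (- C) (x, q) \<partial>lborel) = 0}"
  have E_meas [measurable]: "E \<in> sets borel"
    unfolding E_def by measurable
  have E: "q \<in> E \<longleftrightarrow> ?full q" for q
    unfolding E_def by (simp add: nn_integral_0_iff_AE indicator_def)
  have sections: "AE (q, r) in Q \<Otimes>\<^sub>M Q. degree q r \<noteq> 0 \<longrightarrow> ?full q \<and> ?full r \<or> ?empty q \<and> ?empty r"
    by (rule edge_invariant_sections_null_or_conull[OF assms])
  have "mark_invariant E"
    unfolding mark_invariant_def
  proof (rule eventually_mono[OF sections], simp only: split_paired_all prod.case E, intro impI)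
    fix q r
    assume "degree q r \<noteq> 0 \<longrightarrow> ?full q \<and> ?full r \<or> ?empty q \<and> ?empty r" "degree q r \<noteq> 0"
    then show "?full q \<longleftrightarrow> ?full r"
      using excl by blast
  qed
  from mark_invariant_null_or_conull[OF E_meas this]
  consider "AE q in Q. q \<in> E" | "AE q in Q. q \<notin> E"
    by blast
  then show ?thesis
  proof cases
    case 1
    then have "AE z in L. z \<in> C"
      by (subst AE_marked_lebesgue) (simp_all add: E)
    then show ?thesis ..
  next
    case 2
    have "AE q in Q. AE r in Q. degree q r \<noteq> 0 \<longrightarrow> ?full q \<and> ?full r \<or> ?empty q \<and> ?empty r"
      using QQ.AE_pair[OF sections] by simp
    then have "AE q in Q. ?empty q"
      using 2 degree_integral_pos
    proof eventually_elim
      case (elim q)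
      show ?case
      proof (rule ccontr)
        assume *: "\<not> ?case"
        have "AE r in Q. degree q r = 0"
          using elim(1) by eventually_elim (use * elim(2) in \<open>auto simp: E\<close>)
        with elim(3) show False
          by (simp add: nn_integral_0_iff_AE)
      qed
    qed
    then have "AE z in L. z \<notin> C"
      by (subst AE_marked_lebesgue) simp_all
    then show ?thesis ..
  qed
qed

text \<open>
  If \<open>z\<close> does not reach \<open>w\<close>, then almost no point that \<open>z\<close> reaches has an edge to \<open>w\<close>, for
  otherwise one more step would lead to \<open>w\<close>.
  The intensity \<open>t \<lambda>\<close> of the Poisson process serves as reference measure: only
  the positivity of the kernel matters, and \<open>\<lambda>\<close> and \<open>t \<lambda>\<close> have the same null sets.
\<close>

lemma edge_invariant_reachable:
  assumes t: "t > 0"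
  shows "edge_invariant {w. \<exists>k. conn_iter (scale_measure (ennreal t) L) \<phi> (Suc k) z w \<noteq> 0}"
    (is "edge_invariant ?C")
proof -
  let ?M = "scale_measure (ennreal t) L"
  have sf: "sigma_finite_measure ?M"
    by (intro sigma_finite_scale_measure sigma_finite_marked_lebesgue)
  have sets: "sets ?M = sets borel"
    by (simp add: sets_marked_lebesgue)
  note [measurable] = conn_iter_measurable[OF sf sets]
  note [measurable_cong] = sets
  define C where "C = ?C"
  have C[measurable]: "C \<in> sets borel"
    unfolding C_def by measurable
  have step: "AE y in L. 0 < \<phi> y w \<longrightarrow> y \<in> C \<longrightarrow> w \<in> C" for w
  proof (cases "w \<in> C")
    case False
    have "AE y in ?M. \<forall>k. conn_iter ?M \<phi> (Suc k) z y * ennreal (\<phi> y w) = 0"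
      unfolding AE_all_countable
    proof
      fix k
      have "conn_iter ?M \<phi> (Suc (Suc k)) z w = 0"
        using False unfolding C_def by blast
      then have "(\<integral>\<^sup>+ y. conn_iter ?M \<phi> (Suc k) z y * ennreal (\<phi> y w) \<partial>?M) = 0"
        by simp
      then show "AE y in ?M. conn_iter ?M \<phi> (Suc k) z y * ennreal (\<phi> y w) = 0"
        by (subst (asm) nn_integral_0_iff_AE) measurable
    qed
    then have "AE y in L. \<forall>k. conn_iter ?M \<phi> (Suc k) z y * ennreal (\<phi> y w) = 0"
      unfolding AE_scale_measure_iff[OF t] .
    then show ?thesis
      by eventually_elim (auto simp: C_def ennreal_eq_0_iff)
  qed simp
  then have 1: "AE w in L. AE y in L. 0 < \<phi> y w \<longrightarrow> y \<in> C \<longrightarrow> w \<in> C"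
    by simp
  have "AE y in L. 0 < \<phi> w y \<longrightarrow> y \<in> C \<longrightarrow> w \<in> C" for w
    using step by (subst phi_sym)
  moreover have "{p \<in> space (L \<Otimes>\<^sub>M L). 0 < \<phi> (fst p) (snd p) \<longrightarrow> snd p \<in> C \<longrightarrow> fst p \<in> C}
      \<in> sets (L \<Otimes>\<^sub>M L)"
    by measurable
  ultimately have 2: "AE y in L. AE w in L. 0 < \<phi> w y \<longrightarrow> y \<in> C \<longrightarrow> w \<in> C"
    using LL.AE_commute[of "\<lambda>w y. 0 < \<phi> w y \<longrightarrow> y \<in> C \<longrightarrow> w \<in> C"] by simp
  show ?thesis
    unfolding edge_invariant_def C_def[symmetric] using 1 2
  proof eventually_elim
    case (elim w)
    then show ?case
      by eventually_elim blast
  qed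
qed

text \<open>
  The set of points reachable from \<open>z\<close> is null or conull, and it contains the neighbours of \<open>z\<close>, which
  for almost every \<open>z\<close> form a set of positive measure.
\<close>

lemma AE_AE_conn_iter_pos:
  assumes t: "t > 0"
  shows "AE z in L. AE w in L. \<exists>k. conn_iter (scale_measure (ennreal t) L) \<phi> (Suc k) z w \<noteq> 0"
proof -
  let ?M = "scale_measure (ennreal t) L"
  have sf: "sigma_finite_measure ?M"
    by (intro sigma_finite_scale_measure sigma_finite_marked_lebesgue)
  have sets: "sets ?M = sets borel"
    by (simp add: sets_marked_lebesgue)
  note [measurable] = conn_iter_measurable[OF sf sets]
  have meas: "{w. \<exists>k. conn_iter ?M \<phi> (Suc k) z w \<noteq> 0} \<in> sets borel" for z
    by measurable
  have [measurable]: "Measurable.pred borel (\<lambda>z :: 'a \<times> 'm. (\<integral>\<^sup>+ r. degree (snd z) r \<partial>Q) \<noteq> 0)"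
    unfolding borel_prod[symmetric] by measurable
  have "AE z in L. (\<integral>\<^sup>+ r. degree (snd z) r \<partial>Q) \<noteq> 0"
    using degree_integral_pos by (subst AE_marked_lebesgue) (auto elim!: eventually_mono)
  then show ?thesis
  proof eventually_elim
    case (elim z)
    obtain x q where z: "z = (x, q)"
      by (cases z)
    from edge_invariant_null_or_conull[OF meas edge_invariant_reachable[OF t, of z]]
    consider "AE w in L. \<exists>k. conn_iter ?M \<phi> (Suc k) z w \<noteq> 0"
      | "AE w in L. \<not> (\<exists>k. conn_iter ?M \<phi> (Suc k) z w \<noteq> 0)"
      unfolding mem_Collect_eq by blast
    then show ?case
    proof cases
      case 2
      then have "AE w in L. \<not> 0 < \<phi> z w"
      proof eventually_elim
        case (elim w)
        then have "conn_iter ?M \<phi> (Suc 0) z w = 0"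
          by blast
        then show ?case
          by (simp add: ennreal_eq_0_iff not_less)
      qed
      then have "AE r in Q. AE y in lborel. \<not> 0 < \<phi> z (y, r)"
        by (subst (asm) AE_marked_lebesgue) simp_all
      then have "AE r in Q. degree q r = 0"
      proof eventually_elim
        case (elim r)
        from AE_lborel_translate[OF this, of x] show ?case
          by (simp add: z degree_eq_0_iff phi_stationary[of x])
      qed
      with elim show ?thesis
        by (simp add: z nn_integral_0_iff_AE)
    qed
  qed
qed

end


section \<open>Diffuse measures\<close>

locale diffuse_measure = sigma_finite_measure \<mu>
  for \<mu> :: "'x::{second_countable_topology, metric_space} measure" +
  assumes sets_mu [measurable_cong]: "sets \<mu> = sets borel"
    and atomless: "emeasure \<mu> {x} = 0"
begin

lemma space_mu [simp]: "space \<mu> = UNIV"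
  using sets_eq_imp_space_eq[OF sets_mu] by simp

sublocale product_sigma_finite "\<lambda>_ :: nat. \<mu>"
  by (rule product_sigma_finite.intro) (rule sigma_finite_measure_axioms)

lemma AE_PiM_coordinates_distinct:
  fixes I :: "nat set"
  assumes "finite I" "a \<in> I" "b \<in> I" "a \<noteq> b"
  shows "AE x in \<Pi>\<^sub>M i\<in>I. \<mu>. x a \<noteq> x b"
proof -
  define J where "J = I - {a}"
  have J: "finite J" "a \<notin> J" "I = insert a J" "b \<in> J"
    using assms by (auto simp: J_def)
  have [measurable]: "a \<in> insert a J" "b \<in> insert a J"
    using J by auto
  have meas: "{x \<in> space (\<Pi>\<^sub>M i\<in>insert a J. \<mu>). dist (x a) (x b) = 0} \<in> sets (\<Pi>\<^sub>M i\<in>insert a J. \<mu>)"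
    by measurable
  have "emeasure (\<Pi>\<^sub>M i\<in>insert a J. \<mu>) {x \<in> space (\<Pi>\<^sub>M i\<in>insert a J. \<mu>). dist (x a) (x b) = 0} =
      (\<integral>\<^sup>+ x. indicator {x \<in> space (\<Pi>\<^sub>M i\<in>insert a J. \<mu>). dist (x a) (x b) = 0} x \<partial>(\<Pi>\<^sub>M i\<in>insert a J. \<mu>))"
    using meas by simp
  also have "\<dots> = (\<integral>\<^sup>+ x. \<integral>\<^sup>+ y. indicator {x \<in> space (\<Pi>\<^sub>M i\<in>insert a J. \<mu>). dist (x a) (x b) = 0} (x(a := y))
      \<partial>\<mu> \<partial>(\<Pi>\<^sub>M i\<in>J. \<mu>))"
    by (rule product_nn_integral_insert[OF J(1,2)]) (use meas in auto)
  also have "\<dots> \<le> (\<integral>\<^sup>+ x. \<integral>\<^sup>+ y. indicator {x b} y \<partial>\<mu> \<partial>(\<Pi>\<^sub>M i\<in>J. \<mu>))"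
    using J by (intro nn_integral_mono) (auto simp: indicator_def)
  also have "\<dots> = 0"
    by (simp add: atomless sets_mu)
  finally show ?thesis
    unfolding J(3) by (subst AE_iff_measurable[OF meas]) auto
qed

lemma AE_PiM_inj_on:
  fixes I :: "nat set"
  assumes "finite I"
  shows "AE x in \<Pi>\<^sub>M i\<in>I. \<mu>. inj_on x I"
proof -
  have "AE x in \<Pi>\<^sub>M i\<in>I. \<mu>. \<forall>a\<in>I. \<forall>b\<in>I. a \<noteq> b \<longrightarrow> x a \<noteq> x b"
    using assms AE_PiM_coordinates_distinct[OF assms]
    by (intro AE_finite_allI) (auto intro: AE_I2)
  then show ?thesis
    by eventually_elim (auto simp: inj_on_def)
qed

lemma nn_integral_PiM_density_indicator:
  fixes I :: "nat set"
  assumes I: "finite I" and B [measurable]: "\<And>i. i \<in> I \<Longrightarrow> B i \<in> sets borel"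
    and f [measurable]: "f \<in> borel_measurable (\<Pi>\<^sub>M i\<in>I. \<mu>)"
  shows "(\<integral>\<^sup>+ x. f x \<partial>(\<Pi>\<^sub>M i\<in>I. density \<mu> (indicator (B i)))) =
    (\<integral>\<^sup>+ x. (\<Prod>i\<in>I. indicator (B i) (x i)) * f x \<partial>(\<Pi>\<^sub>M i\<in>I. \<mu>))"
proof -
  \<comment> \<open>the factors with indices outside \<open>I\<close> have to be sigma-finite, too\<close>
  define B' where "B' i = (if i \<in> I then B i else UNIV)" for i
  have B': "B' i \<in> sets borel" for i
    using B by (simp add: B'_def)
  note [measurable] = B'
  interpret D: product_sigma_finite "\<lambda>i. density \<mu> (indicator (B' i))"
    by (intro product_sigma_finite.intro sigma_finite_iff_density_finite[THEN iffD2])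
       (auto simp: indicator_def)
  have prod_meas [measurable]:
    "(\<lambda>x. (\<Prod>i\<in>I. indicator (B' i) (x i)) :: ennreal) \<in> borel_measurable (\<Pi>\<^sub>M i\<in>I. \<mu>)"
    by measurable
  have "density (\<Pi>\<^sub>M i\<in>I. \<mu>) (\<lambda>x. \<Prod>i\<in>I. indicator (B' i) (x i)) =
      (\<Pi>\<^sub>M i\<in>I. density \<mu> (indicator (B' i)))"
  proof (rule D.PiM_eqI[OF I])
    show "sets (density (\<Pi>\<^sub>M i\<in>I. \<mu>) (\<lambda>x. \<Prod>i\<in>I. indicator (B' i) (x i))) =
        sets (\<Pi>\<^sub>M i\<in>I. density \<mu> (indicator (B' i)))"
      by (auto intro!: sets_PiM_cong)
  next
    fix R assume "\<And>i. i \<in> I \<Longrightarrow> R i \<in> sets (density \<mu> (indicator (B' i)))"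
    then have R: "R i \<in> sets \<mu>" if "i \<in> I" for i
      using that by simp
    then have PiE: "Pi\<^sub>E I R \<in> sets (\<Pi>\<^sub>M i\<in>I. \<mu>)"
      using I by (intro sets_PiM_I_finite) auto
    have "emeasure (density (\<Pi>\<^sub>M i\<in>I. \<mu>) (\<lambda>x. \<Prod>i\<in>I. indicator (B' i) (x i))) (Pi\<^sub>E I R) =
        (\<integral>\<^sup>+ x. (\<Prod>i\<in>I. indicator (B' i) (x i)) * indicator (Pi\<^sub>E I R) x \<partial>(\<Pi>\<^sub>M i\<in>I. \<mu>))"
      by (rule emeasure_density[OF prod_meas PiE])
    also have "\<dots> = (\<integral>\<^sup>+ x. (\<Prod>i\<in>I. indicator (B' i) (x i) * indicator (R i) (x i)) \<partial>(\<Pi>\<^sub>M i\<in>I. \<mu>))"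
    proof (intro nn_integral_cong)
      fix x assume x: "x \<in> space (\<Pi>\<^sub>M i\<in>I. \<mu>)"
      have "(\<Prod>i\<in>I. indicator (R i) (x i) :: ennreal) = indicator (Pi\<^sub>E I R) x"
        using I x by (auto simp: indicator_def space_PiM PiE_iff intro!: prod_zero)
      then show "(\<Prod>i\<in>I. indicator (B' i) (x i)) * indicator (Pi\<^sub>E I R) x =
          (\<Prod>i\<in>I. indicator (B' i) (x i) * indicator (R i) (x i) :: ennreal)"
        by (simp add: prod.distrib)
    qed
    also have "\<dots> = (\<Prod>i\<in>I. \<integral>\<^sup>+ y. indicator (B' i) y * indicator (R i) y \<partial>\<mu>)"
      using R product_nn_integral_prod[OF I, of "\<lambda>i y. indicator (B' i) y * indicator (R i) y"]
      by simp
    also have "\<dots> = (\<Prod>i\<in>I. emeasure (density \<mu> (indicator (B' i))) (R i))"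
      using R by (intro prod.cong refl) (simp add: emeasure_density)
    finally show "emeasure (density (\<Pi>\<^sub>M i\<in>I. \<mu>) (\<lambda>x. \<Prod>i\<in>I. indicator (B' i) (x i))) (Pi\<^sub>E I R) =
        (\<Prod>i\<in>I. emeasure (density \<mu> (indicator (B' i))) (R i))" .
  qed
  also have "\<dots> = (\<Pi>\<^sub>M i\<in>I. density \<mu> (indicator (B i)))"
    by (intro PiM_cong) (auto simp: B'_def)
  finally have "(\<integral>\<^sup>+ x. f x \<partial>(\<Pi>\<^sub>M i\<in>I. density \<mu> (indicator (B i)))) =
      (\<integral>\<^sup>+ x. f x \<partial>density (\<Pi>\<^sub>M i\<in>I. \<mu>) (\<lambda>x. \<Prod>i\<in>I. indicator (B' i) (x i)))"
    by simp
  also have "\<dots> = (\<integral>\<^sup>+ x. (\<Prod>i\<in>I. indicator (B' i) (x i)) * f x \<partial>(\<Pi>\<^sub>M i\<in>I. \<mu>))"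
    by (rule nn_integral_density) measurable
  also have "\<dots> = (\<integral>\<^sup>+ x. (\<Prod>i\<in>I. indicator (B i) (x i)) * f x \<partial>(\<Pi>\<^sub>M i\<in>I. \<mu>))"
    by (simp add: B'_def cong: prod.cong)
  finally show ?thesis .
qed

text \<open>
  The counts of a Poisson process are independent on disjoint sets, so its moments are directly
  accessible on boxes with disjoint sides. These suffice: a tuple with distinct coordinates lies in
  such a box with sides from a countable basis, and the other tuples form a null set.
\<close>

lemma nn_integral_PiM_pos_on_disjoint_box:
  fixes I :: "nat set"
  assumes I: "finite I" and f [measurable]: "f \<in> borel_measurable (\<Pi>\<^sub>M i\<in>I. \<mu>)"
    and pos: "(\<integral>\<^sup>+ x. f x \<partial>(\<Pi>\<^sub>M i\<in>I. \<mu>)) \<noteq> 0"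
  obtains B where "\<And>i. i \<in> I \<Longrightarrow> open (B i)" "disjoint_family_on B I"
    "(\<integral>\<^sup>+ x. (\<Prod>i\<in>I. indicator (B i) (x i)) * f x \<partial>(\<Pi>\<^sub>M i\<in>I. \<mu>)) \<noteq> 0"
proof -
  obtain \<B> :: "'x set set" where \<B>: "countable \<B>" "topological_basis \<B>"
    using ex_countable_basis by blast
  define F where "F = {B \<in> I \<rightarrow>\<^sub>E \<B>. disjoint_family_on B I}"
  have "countable (I \<rightarrow>\<^sub>E \<B>)"
    using I \<B>(1) by (intro countable_PiE) auto
  then have F: "countable F"
    by (rule countable_subset[rotated]) (auto simp: F_def)
  have openB: "open (B i)" if "B \<in> F" "i \<in> I" for B i
    using that topological_basis_open[OF \<B>(2)] by (auto simp: F_def)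
  have "\<exists>B\<in>F. (\<integral>\<^sup>+ x. (\<Prod>i\<in>I. indicator (B i) (x i)) * f x \<partial>(\<Pi>\<^sub>M i\<in>I. \<mu>)) \<noteq> 0"
  proof (rule ccontr)
    assume *: "\<not> ?thesis"
    have "AE x in (\<Pi>\<^sub>M i\<in>I. \<mu>). \<forall>B\<in>F. (\<Prod>i\<in>I. indicator (B i) (x i)) * f x = 0"
      unfolding AE_ball_countable[OF F]
    proof
      fix B assume B: "B \<in> F"
      have [measurable]: "B i \<in> sets borel" if "i \<in> I" for i
        using openB[OF B that] by simp
      have "(\<lambda>x. (\<Prod>i\<in>I. indicator (B i) (x i)) * f x) \<in> borel_measurable (\<Pi>\<^sub>M i\<in>I. \<mu>)"
        by measurable
      then show "AE x in (\<Pi>\<^sub>M i\<in>I. \<mu>). (\<Prod>i\<in>I. indicator (B i) (x i)) * f x = 0"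
        using * B nn_integral_0_iff_AE by blast
    qed
    then have "AE x in (\<Pi>\<^sub>M i\<in>I. \<mu>). f x = 0"
      using AE_PiM_inj_on[OF I]
    proof eventually_elim
      case (elim x)
      have "\<exists>B\<in>F. \<forall>i\<in>I. x i \<in> B i"
      proof -
        have fin: "finite (x ` I)"
          using I by simp
        have "\<exists>r>0. \<forall>i\<in>I. \<forall>j\<in>I. i \<noteq> j \<longrightarrow> 2 * r \<le> dist (x i) (x j)"
        proof -
          define D where "D = insert 1 ((\<lambda>(i, j). dist (x i) (x j)) ` {(i, j) \<in> I \<times> I. i \<noteq> j})"
          have "finite {(i, j) \<in> I \<times> I. i \<noteq> j}"
            by (rule finite_subset[of _ "I \<times> I"]) (use I in auto)
          then have D: "finite D" "D \<noteq> {}"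
            by (auto simp: D_def)
          have "\<forall>d\<in>D. 0 < d"
            using elim(2) by (auto simp: D_def dest: inj_onD)
          then have "0 < Min D"
            using D by simp
          moreover have "Min D \<le> dist (x i) (x j)" if "i \<in> I" "j \<in> I" "i \<noteq> j" for i j
            using that D by (intro Min_le) (auto simp: D_def)
          ultimately show ?thesis
            by (intro exI[of _ "Min D / 2"]) auto
        qed
        then obtain r where r: "r > 0" "\<And>i j. i \<in> I \<Longrightarrow> j \<in> I \<Longrightarrow> i \<noteq> j \<Longrightarrow> 2 * r \<le> dist (x i) (x j)"
          by blast
        have "\<forall>i. \<exists>b\<in>\<B>. x i \<in> b \<and> b \<subseteq> ball (x i) r"
          using topological_basisE[OF \<B>(2) open_ball] r(1) by (metis centre_in_ball)
        then obtain b where b: "\<And>i. b i \<in> \<B>" "\<And>i. x i \<in> b i" "\<And>i. b i \<subseteq> ball (x i) r"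
          by metis
        have "b i \<inter> b j = {}" if ij: "i \<in> I" "j \<in> I" "i \<noteq> j" for i j
        proof (rule ccontr)
          assume "b i \<inter> b j \<noteq> {}"
          then obtain y where "dist (x i) y < r" "dist (x j) y < r"
            using b(3)[of i] b(3)[of j] by (auto simp: subset_iff)
          then have "dist (x i) (x j) < 2 * r"
            using dist_triangle2[of "x i" "x j" y] by (simp add: dist_commute)
          with r(2)[OF ij] show False by simp
        qed
        then have "restrict b I \<in> F"
          using b(1) by (auto simp: F_def disjoint_family_on_def)
        then show ?thesis
          using b(2) by (intro bexI[of _ "restrict b I"]) auto
      qed
      then obtain B where B: "B \<in> F" "\<forall>i\<in>I. x i \<in> B i"
        by blast
      then have "(\<Prod>i\<in>I. indicator (B i) (x i) :: ennreal) = 1"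
        by simp
      with elim(1) B(1) show "f x = 0"
        by (metis mult_1)
    qed
    then have "(\<integral>\<^sup>+ x. f x \<partial>(\<Pi>\<^sub>M i\<in>I. \<mu>)) = 0"
      by (simp add: nn_integral_0_iff_AE)
    with pos show False ..
  qed
  then obtain B where "B \<in> F"
    "(\<integral>\<^sup>+ x. (\<Prod>i\<in>I. indicator (B i) (x i)) * f x \<partial>(\<Pi>\<^sub>M i\<in>I. \<mu>)) \<noteq> 0"
    by blast
  then show thesis
    by (intro that[of B] openB) (auto simp: F_def)
qed

end


section \<open>Factorial moments of a Poisson process\<close>

lemma poisson_mean_sums:
  fixes m :: real
  shows "(\<lambda>k. real k * (exp (- m) * m ^ k / fact k)) sums m"
proof -
  have "(\<lambda>k. m * exp (- m) * (m ^ k /\<^sub>R fact k)) sums (m * exp (- m) * exp m)"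
    by (intro sums_mult exp_converges)
  moreover have "m * exp (- m) * (m ^ k /\<^sub>R fact k) =
      real (Suc k) * (exp (- m) * m ^ Suc k / fact (Suc k))" for k
    by (simp add: field_simps del: of_nat_Suc)
  moreover have "m * exp (- m) * exp m = m"
    by (simp add: exp_minus)
  ultimately have "(\<lambda>k. real (Suc k) * (exp (- m) * m ^ Suc k / fact (Suc k))) sums m"
    by (simp only:)
  then show ?thesis
    by (subst (asm) sums_Suc_iff) simp
qed

lemma poisson_pmf_sums:
  fixes m :: real
  shows "(\<lambda>k. exp (- m) * m ^ k / fact k) sums 1"
proof -
  have "(\<lambda>k. exp (- m) * (m ^ k /\<^sub>R fact k)) sums (exp (- m) * exp m)"
    by (intro sums_mult exp_converges)
  then show ?thesis
    by (simp add: exp_minus field_simps)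
qed

locale poisson_points = diffuse_measure \<mu> + Omega: prob_space \<Omega>
  for \<mu> :: "'x::{second_countable_topology, metric_space} measure" and \<Omega> :: "'w measure" +
  fixes \<eta> :: "'w \<Rightarrow> 'x measure" and X :: "nat \<Rightarrow> 'w \<Rightarrow> 'x"
  assumes poisson: "poisson_process \<Omega> \<mu> \<eta>"
    and points: "enumerates_points \<Omega> \<eta> X"
begin

lemma X_measurable [measurable]: "X n \<in> borel_measurable \<Omega>"
  using points by (simp add: enumerates_points_def)

lemma count_measurable [measurable]:
  assumes "B \<in> sets borel"
  shows "(\<lambda>\<omega>. emeasure (\<eta> \<omega>) B) \<in> borel_measurable \<Omega>"
  using poisson assms unfolding poisson_process_def point_process_def sets_mu by blast

lemma prob_count:
  assumes "B \<in> sets borel" "emeasure \<mu> B < \<infinity>"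
  shows "measure \<Omega> {\<omega> \<in> space \<Omega>. emeasure (\<eta> \<omega>) B = of_nat k} =
    exp (- measure \<mu> B) * measure \<mu> B ^ k / fact k"
  using poisson assms unfolding poisson_process_def sets_mu by blast

lemma AE_count_infinite:
  assumes "B \<in> sets borel" "emeasure \<mu> B = \<infinity>"
  shows "AE \<omega> in \<Omega>. emeasure (\<eta> \<omega>) B = \<infinity>"
  using poisson assms unfolding poisson_process_def sets_mu by blast

lemma indep_counts:
  assumes "\<And>i. i < m \<Longrightarrow> B i \<in> sets borel" "disjoint_family_on B {..<m::nat}"
  shows "Omega.indep_vars (\<lambda>_. borel) (\<lambda>i \<omega>. emeasure (\<eta> \<omega>) (B i)) {..<m}"
  using poisson assms unfolding poisson_process_def sets_mu by blast

text \<open>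
  The Poisson probabilities of the finite counts add up to one, so the count is almost surely finite
  and its mean is a series over these probabilities.
\<close>

lemma mean_count:
  assumes [measurable]: "B \<in> sets borel"
  shows "(\<integral>\<^sup>+ \<omega>. emeasure (\<eta> \<omega>) B \<partial>\<Omega>) = emeasure \<mu> B"
proof (cases "emeasure \<mu> B = \<infinity>")
  case True
  have "(\<integral>\<^sup>+ \<omega>. emeasure (\<eta> \<omega>) B \<partial>\<Omega>) = (\<integral>\<^sup>+ \<omega>. \<infinity> \<partial>\<Omega>)"
    using AE_count_infinite[OF assms True] by (intro nn_integral_cong_AE) auto
  then show ?thesis
    using True by (simp add: Omega.emeasure_space_1)
next
  case False
  then have fin: "emeasure \<mu> B < \<infinity>"
    by (simp add: top.not_eq_extremum)
  define m where "m = measure \<mu> B"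
  have m: "emeasure \<mu> B = ennreal m" "m \<ge> 0"
    using False by (auto simp: m_def emeasure_eq_ennreal_measure)
  define N where "N k = {\<omega> \<in> space \<Omega>. emeasure (\<eta> \<omega>) B = of_nat k}" for k
  have [measurable]: "N k \<in> sets \<Omega>" for k
    unfolding N_def by measurable
  have N: "emeasure \<Omega> (N k) = ennreal (exp (- m) * m ^ k / fact k)" for k
    using prob_count[OF assms fin] by (simp add: Omega.emeasure_eq_measure N_def m_def)
  have disj: "disjoint_family N"
    by (auto simp: disjoint_family_on_def N_def)
  have "emeasure \<Omega> (\<Union>k. N k) = (\<Sum>k. emeasure \<Omega> (N k))"
    by (intro suminf_emeasure[symmetric] disj) auto
  also have "\<dots> = ennreal 1"
    unfolding N using m(2) poisson_pmf_sums[of m] by (intro sums_unique[symmetric] sums_ennreal[THEN iffD2]) auto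
  finally have "AE \<omega> in \<Omega>. \<omega> \<in> (\<Union>k. N k)"
    by (intro Omega.AE_prob_1) (simp add: Omega.emeasure_eq_measure)
  then have "(\<integral>\<^sup>+ \<omega>. emeasure (\<eta> \<omega>) B \<partial>\<Omega>) = (\<integral>\<^sup>+ \<omega>. (\<Sum>k. of_nat k * indicator (N k) \<omega>) \<partial>\<Omega>)"
  proof (intro nn_integral_cong_AE, eventually_elim)
    case (elim \<omega>)
    then obtain k where k: "\<omega> \<in> N k" by blast
    have "(\<Sum>j. of_nat j * indicator (N j) \<omega> :: ennreal) = (\<Sum>j. of_nat k * indicator (N j) \<omega>)"
      using k by (intro suminf_cong) (auto simp: N_def indicator_def)
    also have "\<dots> = of_nat k"
      using suminf_cmult_indicator[OF disj k, of "\<lambda>_. of_nat k"] .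
    finally show ?case
      using k by (simp add: N_def)
  qed
  also have "\<dots> = (\<Sum>k. of_nat k * emeasure \<Omega> (N k))"
    by (simp add: nn_integral_suminf nn_integral_cmult)
  also have "\<dots> = (\<Sum>k. ennreal (real k * (exp (- m) * m ^ k / fact k)))"
    using m(2) by (intro suminf_cong, subst N, subst ennreal_mult)
      (simp_all add: ennreal_of_nat_eq_real_of_nat)
  also have "\<dots> = ennreal m"
    using m(2) poisson_mean_sums[of m]
    by (intro sums_unique[symmetric] sums_ennreal[THEN iffD2]) auto
  finally show ?thesis
    by (simp add: m)
qed

lemma AE_count_eq:
  "AE \<omega> in \<Omega>. \<forall>B\<in>sets borel. emeasure (\<eta> \<omega>) B =
    (\<integral>\<^sup>+ n. indicator B (X n \<omega>) \<partial>count_space UNIV)"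
proof -
  have "AE \<omega> in \<Omega>. \<eta> \<omega> = distr (count_space UNIV) borel (\<lambda>n. X n \<omega>)"
    using points by (simp add: enumerates_points_def)
  then show ?thesis
  proof eventually_elim
    case (elim \<omega>)
    have "emeasure (\<eta> \<omega>) B = (\<integral>\<^sup>+ n. indicator B (X n \<omega>) \<partial>count_space UNIV)"
      if B: "B \<in> sets borel" for B
    proof -
      have "emeasure (\<eta> \<omega>) B = (\<integral>\<^sup>+ x. indicator B x \<partial>distr (count_space UNIV) borel (\<lambda>n. X n \<omega>))"
        unfolding elim using B by simp
      also have "\<dots> = (\<integral>\<^sup>+ n. indicator B (X n \<omega>) \<partial>count_space UNIV)"
        using B by (intro nn_integral_distr) auto
      finally show ?thesis .
    qed
    then show ?case
      by blast
  qed
qed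

abbreviation index_tuples :: "nat \<Rightarrow> (nat \<Rightarrow> nat) measure" where
  "index_tuples k \<equiv> \<Pi>\<^sub>M j\<in>{..<k}. count_space UNIV"

text \<open>
  The points that an index tuple selects, as a function of the outcome and the tuple. Counting measure
  on the tuples makes the integral of a function of \<open>sample k\<close> the expected sum over all \<open>k\<close>-tuples of
  points of the process.
\<close>

definition sample :: "nat \<Rightarrow> 'w \<times> (nat \<Rightarrow> nat) \<Rightarrow> nat \<Rightarrow> 'x" where
  "sample k p = (\<lambda>j\<in>{..<k}. X (snd p j) (fst p))"

lemma sample_measurable [measurable]:
  "sample k \<in> (\<Omega> \<Otimes>\<^sub>M index_tuples k) \<rightarrow>\<^sub>M (\<Pi>\<^sub>M j\<in>{..<k}. \<mu>)"
  unfolding sample_def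
proof (rule measurable_restrict)
  fix j assume j: "j \<in> {..<k}"
  have [measurable]: "(\<lambda>p. snd p j) \<in> (\<Omega> \<Otimes>\<^sub>M index_tuples k) \<rightarrow>\<^sub>M count_space UNIV"
    using j by measurable
  show "(\<lambda>p. X (snd p j) (fst p)) \<in> (\<Omega> \<Otimes>\<^sub>M index_tuples k) \<rightarrow>\<^sub>M \<mu>"
    by (rule measurable_compose_countable[where f = "\<lambda>i p. X i (fst p)"]) measurable
qed

lemma sample_component_measurable [measurable]:
  "j < k \<Longrightarrow> (\<lambda>p. sample k p j) \<in> borel_measurable (\<Omega> \<Otimes>\<^sub>M index_tuples k)"
  using measurable_compose[OF sample_measurable[of k] measurable_component_singleton[of j "{..<k}"]]
  by (simp add: measurable_cong_sets[OF refl sets_mu])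

text \<open>
  Both sides integrate \<open>f\<close> with respect to a measure on \<open>k\<close>-tuples that is concentrated on the box
  with sides \<open>B j\<close>. On a smaller box with sides \<open>B j \<inter> R j\<close>, the measure on the left is the expectation
  of the product of the counts in the sides; by independence this is the product of the means, which
  are the values of the intensity. Agreement on boxes determines a measure on the product space.
\<close>

lemma factorial_moment_disjoint_boxes:
  assumes B [measurable]: "\<And>j. j < k \<Longrightarrow> B j \<in> sets borel" and disj: "disjoint_family_on B {..<k}"
    and f [measurable]: "f \<in> borel_measurable (\<Pi>\<^sub>M j\<in>{..<k}. \<mu>)"
  shows "(\<integral>\<^sup>+ p. (\<Prod>j<k. indicator (B j) (sample k p j)) * f (sample k p) \<partial>(\<Omega> \<Otimes>\<^sub>M index_tuples k)) =
    (\<integral>\<^sup>+ x. (\<Prod>j<k. indicator (B j) (x j)) * f x \<partial>(\<Pi>\<^sub>M j\<in>{..<k}. \<mu>))"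
proof -
  interpret D: product_sigma_finite "\<lambda>j. density \<mu> (indicator (if j < k then B j else UNIV))"
    using B by (intro product_sigma_finite.intro sigma_finite_iff_density_finite[THEN iffD2])
       (auto simp: indicator_def)
  interpret C: product_sigma_finite "\<lambda>_ :: nat. count_space (UNIV :: nat set)"
    by (intro product_sigma_finite.intro sigma_finite_measure_count_space)
  interpret C: finite_product_sigma_finite "\<lambda>_ :: nat. count_space (UNIV :: nat set)" "{..<k}"
    by standard auto
  have C_sf: "sigma_finite_measure (index_tuples k)"
    by (rule C.sigma_finite_measure_axioms)
  let ?P = "\<Omega> \<Otimes>\<^sub>M index_tuples k"
  let ?w = "\<lambda>p. \<Prod>j<k. indicator (B j) (sample k p j) :: ennreal"
  have w [measurable]: "?w \<in> borel_measurable ?P"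
    by measurable
  have "distr (density ?P ?w) (\<Pi>\<^sub>M j\<in>{..<k}. \<mu>) (sample k) =
      (\<Pi>\<^sub>M j\<in>{..<k}. density \<mu> (indicator (if j < k then B j else UNIV)))"
  proof (rule D.PiM_eqI)
    show "sets (distr (density ?P ?w) (\<Pi>\<^sub>M j\<in>{..<k}. \<mu>) (sample k)) =
        sets (\<Pi>\<^sub>M j\<in>{..<k}. density \<mu> (indicator (if j < k then B j else UNIV)))"
      by (auto intro!: sets_PiM_cong)
  next
    fix R assume "\<And>j. j \<in> {..<k} \<Longrightarrow> R j \<in> sets (density \<mu> (indicator (if j < k then B j else UNIV)))"
    then have R [measurable]: "R j \<in> sets borel" if "j < k" for j
      using that by (simp add: sets_mu)
    have PiE [measurable]: "Pi\<^sub>E {..<k} R \<in> sets (\<Pi>\<^sub>M j\<in>{..<k}. \<mu>)"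
      using R by (intro sets_PiM_I_finite) (auto simp: sets_mu)
    have BR: "B j \<inter> R j \<in> sets borel" if "j < k" for j
      using that by measurable
    have "emeasure (distr (density ?P ?w) (\<Pi>\<^sub>M j\<in>{..<k}. \<mu>) (sample k)) (Pi\<^sub>E {..<k} R) =
        (\<integral>\<^sup>+ p. ?w p * indicator (Pi\<^sub>E {..<k} R) (sample k p) \<partial>?P)"
      using PiE by (subst nn_integral_indicator[symmetric], simp, subst nn_integral_distr, simp_all,
          subst nn_integral_density, simp_all)
    also have "\<dots> = (\<integral>\<^sup>+ p. (\<Prod>j<k. indicator (B j \<inter> R j) (X (snd p j) (fst p))) \<partial>?P)"
    proof (intro nn_integral_cong)
      fix p
      have "(\<Prod>j<k. indicator (R j) (sample k p j) :: ennreal) = indicator (Pi\<^sub>E {..<k} R) (sample k p)"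
        by (auto simp: indicator_def sample_def PiE_iff intro!: prod_zero)
      then have "?w p * indicator (Pi\<^sub>E {..<k} R) (sample k p) =
          (\<Prod>j<k. indicator (B j) (sample k p j) * indicator (R j) (sample k p j))"
        by (simp add: prod.distrib)
      also have "\<dots> = (\<Prod>j<k. indicator (B j \<inter> R j) (X (snd p j) (fst p)))"
        by (intro prod.cong) (auto simp: sample_def indicator_def)
      finally show "?w p * indicator (Pi\<^sub>E {..<k} R) (sample k p) = \<dots>" .
    qed
    also have "\<dots> = (\<integral>\<^sup>+ \<omega>. \<integral>\<^sup>+ i. (\<Prod>j<k. indicator (B j \<inter> R j) (X (i j) \<omega>)) \<partial>index_tuples k \<partial>\<Omega>)"
    proof -
      have "(\<lambda>p. \<Prod>j<k. indicator (B j \<inter> R j) (sample k p j) :: ennreal) \<in> borel_measurable ?P"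
        by measurable
      also have "(\<lambda>p. \<Prod>j<k. indicator (B j \<inter> R j) (sample k p j) :: ennreal) =
          (\<lambda>p. \<Prod>j<k. indicator (B j \<inter> R j) (X (snd p j) (fst p)))"
        by (simp add: sample_def)
      finally show ?thesis
        by (subst sigma_finite_measure.nn_integral_fst[OF C_sf, symmetric]) simp_all
    qed
    also have "\<dots> = (\<integral>\<^sup>+ \<omega>. (\<Prod>j<k. \<integral>\<^sup>+ n. indicator (B j \<inter> R j) (X n \<omega>) \<partial>count_space UNIV) \<partial>\<Omega>)"
      using C.product_nn_integral_prod[of "{..<k}" "\<lambda>j n. indicator (B j \<inter> R j) (X n \<omega>)" for \<omega>]
      by simp
    also have "\<dots> = (\<integral>\<^sup>+ \<omega>. (\<Prod>j<k. emeasure (\<eta> \<omega>) (B j \<inter> R j)) \<partial>\<Omega>)"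
      using AE_count_eq
    proof (intro nn_integral_cong_AE, eventually_elim)
      case (elim \<omega>)
      then show ?case
        using BR by (intro prod.cong) auto
    qed
    also have "\<dots> = (\<Prod>j<k. \<integral>\<^sup>+ \<omega>. emeasure (\<eta> \<omega>) (B j \<inter> R j) \<partial>\<Omega>)"
    proof (rule Omega.indep_vars_nn_integral)
      show "Omega.indep_vars (\<lambda>_. borel) (\<lambda>j \<omega>. emeasure (\<eta> \<omega>) (B j \<inter> R j)) {..<k}"
        using BR disj by (intro indep_counts) (auto simp: disjoint_family_on_def)
    qed auto
    also have "\<dots> = (\<Prod>j<k. emeasure \<mu> (B j \<inter> R j))"
      using BR by (intro prod.cong mean_count) auto
    also have "\<dots> = (\<Prod>j<k. emeasure (density \<mu> (indicator (if j < k then B j else UNIV))) (R j))"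
    proof (intro prod.cong refl)
      fix j assume "j \<in> {..<k}"
      then have "B j \<in> sets \<mu>" "R j \<in> sets \<mu>" "j < k"
        using B R by (auto simp: sets_mu)
      then show "emeasure \<mu> (B j \<inter> R j) = emeasure (density \<mu> (indicator (if j < k then B j else UNIV))) (R j)"
        by (simp add: emeasure_density flip: indicator_inter_arith)
    qed
    finally show "emeasure (distr (density ?P ?w) (\<Pi>\<^sub>M j\<in>{..<k}. \<mu>) (sample k)) (Pi\<^sub>E {..<k} R) =
        (\<Prod>j<k. emeasure (density \<mu> (indicator (if j < k then B j else UNIV))) (R j))" .
  qed simp
  also have "\<dots> = (\<Pi>\<^sub>M j\<in>{..<k}. density \<mu> (indicator (B j)))"
    by (intro PiM_cong) auto
  finally have "(\<integral>\<^sup>+ x. f x \<partial>distr (density ?P ?w) (\<Pi>\<^sub>M j\<in>{..<k}. \<mu>) (sample k)) =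
      (\<integral>\<^sup>+ x. f x \<partial>(\<Pi>\<^sub>M j\<in>{..<k}. density \<mu> (indicator (B j))))"
    by simp
  also have "(\<integral>\<^sup>+ x. f x \<partial>distr (density ?P ?w) (\<Pi>\<^sub>M j\<in>{..<k}. \<mu>) (sample k)) =
      (\<integral>\<^sup>+ p. ?w p * f (sample k p) \<partial>?P)"
    by (subst nn_integral_distr, simp_all, subst nn_integral_density, simp_all)
  also have "(\<integral>\<^sup>+ x. f x \<partial>(\<Pi>\<^sub>M j\<in>{..<k}. density \<mu> (indicator (B j)))) =
      (\<integral>\<^sup>+ x. (\<Prod>j<k. indicator (B j) (x j)) * f x \<partial>(\<Pi>\<^sub>M j\<in>{..<k}. \<mu>))"
    using B by (intro nn_integral_PiM_density_indicator f) auto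
  finally show ?thesis .
qed

text \<open>
  A set of \<open>k\<close>-tuples that is not null for the intensity is hit by points of the process. The sum over
  index tuples is countable, so one fixed tuple of indices hits it with positive probability, and
  since the sides of the box are disjoint, its indices are distinct.
\<close>

lemma points_hit_nonnull_functions:
  fixes k :: nat
  assumes f [measurable]: "f \<in> borel_measurable (\<Pi>\<^sub>M j\<in>{..<k}. \<mu>)"
    and pos: "(\<integral>\<^sup>+ x. f x \<partial>(\<Pi>\<^sub>M j\<in>{..<k}. \<mu>)) \<noteq> 0"
  obtains i where "inj_on i {..<k}" "(\<integral>\<^sup>+ \<omega>. f (\<lambda>j\<in>{..<k}. X (i j) \<omega>) \<partial>\<Omega>) \<noteq> 0"
proof -
  obtain B where B: "\<And>j. j \<in> {..<k} \<Longrightarrow> open (B j)" "disjoint_family_on B {..<k}"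
    "(\<integral>\<^sup>+ x. (\<Prod>j<k. indicator (B j) (x j)) * f x \<partial>(\<Pi>\<^sub>M j\<in>{..<k}. \<mu>)) \<noteq> 0"
    using nn_integral_PiM_pos_on_disjoint_box[OF finite_lessThan f pos] by metis
  have [measurable]: "B j \<in> sets borel" if "j < k" for j
    using B(1) that by simp
  interpret C: product_sigma_finite "\<lambda>_ :: nat. count_space (UNIV :: nat set)"
    by (intro product_sigma_finite.intro sigma_finite_measure_count_space)
  interpret C: finite_product_sigma_finite "\<lambda>_ :: nat. count_space (UNIV :: nat set)" "{..<k}"
    by standard auto
  interpret PC: pair_sigma_finite \<Omega> "index_tuples k"
    by (intro pair_sigma_finite.intro C.sigma_finite_measure_axioms Omega.sigma_finite_measure_axioms)
  let ?g = "\<lambda>p. (\<Prod>j<k. indicator (B j) (sample k p j)) * f (sample k p)"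
  have [measurable]: "?g \<in> borel_measurable (\<Omega> \<Otimes>\<^sub>M index_tuples k)"
    by measurable
  have "(\<integral>\<^sup>+ p. ?g p \<partial>(\<Omega> \<Otimes>\<^sub>M index_tuples k)) \<noteq> 0"
    using B by (subst factorial_moment_disjoint_boxes) auto
  then have "(\<integral>\<^sup>+ i. \<integral>\<^sup>+ \<omega>. ?g (\<omega>, i) \<partial>\<Omega> \<partial>index_tuples k) \<noteq> 0"
    using PC.nn_integral_snd[of ?g] by simp
  then have "\<exists>i. (\<integral>\<^sup>+ \<omega>. ?g (\<omega>, i) \<partial>\<Omega>) \<noteq> 0"
    by (rule contrapos_np) simp
  then obtain i where i: "(\<integral>\<^sup>+ \<omega>. ?g (\<omega>, i) \<partial>\<Omega>) \<noteq> 0"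
    by blast
  show thesis
  proof
    have "\<exists>\<omega>. ?g (\<omega>, i) \<noteq> 0"
    proof (rule ccontr)
      assume "\<not> ?thesis"
      then have "?g (\<omega>, i) = 0" for \<omega>
        by blast
      then have "(\<integral>\<^sup>+ \<omega>. ?g (\<omega>, i) \<partial>\<Omega>) = (\<integral>\<^sup>+ \<omega>. 0 \<partial>\<Omega>)"
        by (intro nn_integral_cong)
      with i show False
        by simp
    qed
    then obtain \<omega> where "?g (\<omega>, i) \<noteq> 0"
      by blast
    then have hit: "X (i j) \<omega> \<in> B j" if "j < k" for j
      using that by (auto simp: sample_def indicator_def split: if_splits)
    show "inj_on i {..<k}"
    proof (rule inj_onI, rule ccontr)
      fix a b assume ab: "a \<in> {..<k}" "b \<in> {..<k}" "i a = i b" "a \<noteq> b"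
      then have "X (i a) \<omega> \<in> B a \<inter> B b"
        using hit[of a] hit[of b] by simp
      with B(2) ab show False
        unfolding disjoint_family_on_def by blast
    qed
    have "(\<integral>\<^sup>+ \<omega>. ?g (\<omega>, i) \<partial>\<Omega>) \<le> (\<integral>\<^sup>+ \<omega>. f (sample k (\<omega>, i)) \<partial>\<Omega>)"
    proof (intro nn_integral_mono)
      fix \<omega>
      have "(\<Prod>j<k. indicator (B j) (sample k (\<omega>, i) j) :: ennreal) \<le> (\<Prod>j<k. 1)"
        by (intro prod_mono_ennreal) (simp add: indicator_def)
      then show "?g (\<omega>, i) \<le> f (sample k (\<omega>, i))"
        using mult_right_mono[of _ 1 "f (sample k (\<omega>, i))"] by simp
    qed
    with i show "(\<integral>\<^sup>+ \<omega>. f (\<lambda>j\<in>{..<k}. X (i j) \<omega>) \<partial>\<Omega>) \<noteq> 0"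
      by (auto simp: sample_def)
  qed
qed

end


section \<open>Chains of points\<close>

definition chain_vertex :: "nat \<Rightarrow> 'x \<Rightarrow> 'x \<Rightarrow> (nat \<Rightarrow> 'x) \<Rightarrow> nat \<Rightarrow> 'x" where
  "chain_vertex k z w x j = (if j = 0 then z else if j \<le> k then x (j - 1) else w)"

text \<open>
  The integrand of the iterated kernel of order \<open>k + 1\<close>, with \<open>k\<close> intermediate points.
\<close>

definition chain_weight :: "('x \<Rightarrow> 'x \<Rightarrow> real) \<Rightarrow> nat \<Rightarrow> 'x \<Rightarrow> 'x \<Rightarrow> (nat \<Rightarrow> 'x) \<Rightarrow> ennreal" where
  "chain_weight \<phi> k z w x =
    (\<Prod>j\<le>k. ennreal (\<phi> (chain_vertex k z w x j) (chain_vertex k z w x (Suc j))))"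

lemma chain_weight_0: "chain_weight \<phi> 0 z w x = ennreal (\<phi> z w)"
  by (simp add: chain_weight_def chain_vertex_def)

lemma chain_weight_Suc:
  "chain_weight \<phi> (Suc k) z w x = chain_weight \<phi> k z (x k) x * ennreal (\<phi> (x k) w)"
proof -
  have *: "chain_vertex (Suc k) z w x j = chain_vertex k z (x k) x j" if "j \<le> Suc k" for j
    using that by (auto simp: chain_vertex_def le_Suc_eq)
  have "(\<Prod>j\<le>k. ennreal (\<phi> (chain_vertex (Suc k) z w x j) (chain_vertex (Suc k) z w x (Suc j)))) =
      (\<Prod>j\<le>k. ennreal (\<phi> (chain_vertex k z (x k) x j) (chain_vertex k z (x k) x (Suc j))))"
    by (intro prod.cong refl) (simp add: *)
  then show ?thesis
    unfolding chain_weight_def prod.atMost_Suc by (simp add: chain_vertex_def)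
qed

lemma chain_weight_cong:
  assumes "\<And>j. j < k \<Longrightarrow> x j = y j"
  shows "chain_weight \<phi> k z w x = chain_weight \<phi> k z w y"
proof -
  have "chain_vertex k z w x = chain_vertex k z w y"
    using assms by (auto simp: chain_vertex_def fun_eq_iff)
  then show ?thesis
    by (simp add: chain_weight_def)
qed

lemma chain_weight_neq_0_iff:
  "chain_weight \<phi> k z w x \<noteq> 0 \<longleftrightarrow>
    (\<forall>j\<le>k. 0 < \<phi> (chain_vertex k z w x j) (chain_vertex k z w x (Suc j)))"
  by (auto simp: chain_weight_def ennreal_eq_0_iff not_le)

context connection_model
begin

lemma chain_weight_measurable:
  assumes "\<And>j. j < k \<Longrightarrow> (\<lambda>x. h x j) \<in> borel_measurable N" "g \<in> borel_measurable N"
  shows "(\<lambda>x. chain_weight \<phi> k z (g x) (h x)) \<in> borel_measurable N"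
  using assms
proof (induction k arbitrary: g)
  case 0
  note 0(2) [measurable]
  show ?case
    unfolding chain_weight_0 by measurable
next
  case (Suc k)
  have [measurable]: "(\<lambda>x. h x k) \<in> borel_measurable N" "g \<in> borel_measurable N"
    using Suc.prems by auto
  have [measurable]: "(\<lambda>x. chain_weight \<phi> k z (h x k) (h x)) \<in> borel_measurable N"
    using Suc.prems by (intro Suc.IH) auto
  show ?case
    unfolding chain_weight_Suc by measurable
qed

lemma nn_integral_chain_weight:
  assumes "diffuse_measure M"
  shows "(\<integral>\<^sup>+ x. chain_weight \<phi> k z w x \<partial>(\<Pi>\<^sub>M j\<in>{..<k}. M)) = conn_iter M \<phi> (Suc k) z w"
proof (induction k arbitrary: w)
  case 0
  interpret diffuse_measure M by fact
  show ?case
    by (simp add: chain_weight_0 PiM_empty)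
next
  case (Suc k)
  interpret diffuse_measure M by fact
  have component: "(\<lambda>x. x j) \<in> borel_measurable (\<Pi>\<^sub>M j\<in>J. M)" if "j \<in> J" for j :: nat and J
    using measurable_component_singleton[OF that, of "\<lambda>_. M"]
    by (simp add: measurable_cong_sets[OF refl sets_mu])
  have meas_Suc: "chain_weight \<phi> (Suc k) z w \<in> borel_measurable (\<Pi>\<^sub>M j\<in>insert k {..<k}. M)"
    by (rule chain_weight_measurable) (auto intro: component)
  have [measurable]: "chain_weight \<phi> k z y \<in> borel_measurable (\<Pi>\<^sub>M j\<in>{..<k}. M)" for y
    by (rule chain_weight_measurable) (auto intro: component)
  have "(\<integral>\<^sup>+ x. chain_weight \<phi> (Suc k) z w x \<partial>(\<Pi>\<^sub>M j\<in>{..<Suc k}. M)) =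
      (\<integral>\<^sup>+ y. \<integral>\<^sup>+ x. chain_weight \<phi> (Suc k) z w (x(k := y)) \<partial>(\<Pi>\<^sub>M j\<in>{..<k}. M) \<partial>M)"
    unfolding lessThan_Suc by (rule product_nn_integral_insert_rev[OF _ _ meas_Suc]) auto
  also have "\<dots> = (\<integral>\<^sup>+ y. \<integral>\<^sup>+ x. chain_weight \<phi> k z y x * ennreal (\<phi> y w) \<partial>(\<Pi>\<^sub>M j\<in>{..<k}. M) \<partial>M)"
  proof (intro nn_integral_cong)
    fix y x
    have "chain_weight \<phi> k z y (x(k := y)) = chain_weight \<phi> k z y x"
      by (rule chain_weight_cong) simp
    then show "chain_weight \<phi> (Suc k) z w (x(k := y)) = chain_weight \<phi> k z y x * ennreal (\<phi> y w)"
      by (simp add: chain_weight_Suc)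
  qed
  also have "\<dots> = (\<integral>\<^sup>+ y. conn_iter M \<phi> (Suc k) z y * ennreal (\<phi> y w) \<partial>M)"
    by (simp add: nn_integral_multc Suc.IH)
  finally show ?case
    by simp
qed

end


section \<open>Open edges\<close>

locale rcm_marks = Omega: prob_space \<Omega> for \<Omega> :: "'w measure" +
  fixes \<phi> :: "'x::{second_countable_topology, metric_space} \<Rightarrow> 'x \<Rightarrow> real"
    and X :: "nat \<Rightarrow> 'w \<Rightarrow> 'x" and U :: "nat set \<Rightarrow> 'w \<Rightarrow> real"
  assumes \<phi>_measurable: "(\<lambda>(z, w). \<phi> z w) \<in> borel_measurable (borel \<Otimes>\<^sub>M borel)"
    and X_borel [measurable]: "\<And>n. X n \<in> borel_measurable \<Omega>"
    and marks: "edge_marks \<Omega> X U"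
begin

lemma \<phi>_comp_measurable [measurable (raw)]:
  assumes "f \<in> borel_measurable M" "g \<in> borel_measurable M"
  shows "(\<lambda>x. \<phi> (f x) (g x)) \<in> borel_measurable M"
  using measurable_compose[OF measurable_Pair[OF assms] \<phi>_measurable] by simp

lemma U_measurable: "m \<noteq> n \<Longrightarrow> U {m, n} \<in> borel_measurable \<Omega>"
  using marks by (auto simp: edge_marks_def index_pairs_def)

text \<open>
  Whether two enumerated points are joined by a path of a given length is determined by countably
  many points and edge marks. Equality of points is expressed by the distance, for which measurability is immediate.
\<close>

lemma path_connected_event:
  assumes Y [measurable]: "\<And>n. Y n \<in> borel_measurable \<Omega>"
  shows "{\<omega> \<in> space \<Omega>. path_connected_in (rcm \<phi> Y U \<omega>) (Y a \<omega>) (Y b \<omega>)} \<in> sets \<Omega>"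
proof -
  define E where "E \<omega> = snd (rcm \<phi> Y U \<omega>)" for \<omega>
  have edge: "(Y l \<omega>, Y n \<omega>) \<in> E \<omega> \<longleftrightarrow> (\<exists>i j. i \<noteq> j \<and> dist (Y i \<omega>) (Y l \<omega>) = 0 \<and> dist (Y j \<omega>) (Y n \<omega>) = 0 \<and>
      dist (Y i \<omega>) (Y j \<omega>) \<noteq> 0 \<and> U {i, j} \<omega> \<le> \<phi> (Y i \<omega>) (Y j \<omega>))" for l n \<omega>
  proof
    assume "(Y l \<omega>, Y n \<omega>) \<in> E \<omega>"
    then obtain i j where "Y l \<omega> = Y i \<omega>" "Y n \<omega> = Y j \<omega>" "Y i \<omega> \<noteq> Y j \<omega>"
      "U {i, j} \<omega> \<le> \<phi> (Y i \<omega>) (Y j \<omega>)"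
      unfolding E_def rcm_def rcm_graph_def by auto
    then show "\<exists>i j. i \<noteq> j \<and> dist (Y i \<omega>) (Y l \<omega>) = 0 \<and> dist (Y j \<omega>) (Y n \<omega>) = 0 \<and>
        dist (Y i \<omega>) (Y j \<omega>) \<noteq> 0 \<and> U {i, j} \<omega> \<le> \<phi> (Y i \<omega>) (Y j \<omega>)"
      by (intro exI[of _ i] exI[of _ j]) auto
  next
    assume "\<exists>i j. i \<noteq> j \<and> dist (Y i \<omega>) (Y l \<omega>) = 0 \<and> dist (Y j \<omega>) (Y n \<omega>) = 0 \<and>
        dist (Y i \<omega>) (Y j \<omega>) \<noteq> 0 \<and> U {i, j} \<omega> \<le> \<phi> (Y i \<omega>) (Y j \<omega>)"
    then obtain i j where "Y i \<omega> = Y l \<omega>" "Y j \<omega> = Y n \<omega>" "Y i \<omega> \<noteq> Y j \<omega>"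
      "U {i, j} \<omega> \<le> \<phi> (Y i \<omega>) (Y j \<omega>)"
      by auto
    then show "(Y l \<omega>, Y n \<omega>) \<in> E \<omega>"
      unfolding E_def rcm_def rcm_graph_def snd_conv
      by (intro CollectI exI[of _ i] exI[of _ j]) simp
  qed
  have pair_meas: "Measurable.pred \<Omega> (\<lambda>\<omega>. i \<noteq> j \<and> dist (Y i \<omega>) (Y l \<omega>) = 0 \<and> dist (Y j \<omega>) (Y n \<omega>) = 0 \<and>
      dist (Y i \<omega>) (Y j \<omega>) \<noteq> 0 \<and> U {i, j} \<omega> \<le> \<phi> (Y i \<omega>) (Y j \<omega>))" for i j l n
  proof (cases "i = j")
    case False
    note U_measurable[OF False, measurable]
    show ?thesis
      by measurable
  qed simp
  have edge_meas [measurable]: "Measurable.pred \<Omega> (\<lambda>\<omega>. (Y l \<omega>, Y n \<omega>) \<in> E \<omega>)" for l n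
    unfolding edge by (intro pred_intros_countable pair_meas)
  have steps [measurable]: "Measurable.pred \<Omega> (\<lambda>\<omega>. (Y a \<omega>, Y n \<omega>) \<in> E \<omega> ^^ k)" for k n
  proof (induction k arbitrary: n)
    case 0
    have "Measurable.pred \<Omega> (\<lambda>\<omega>. dist (Y a \<omega>) (Y n \<omega>) = 0)"
      by measurable
    then show ?case
      by simp
  next
    case (Suc k)
    note Suc.IH [measurable]
    have "(Y a \<omega>, Y n \<omega>) \<in> E \<omega> ^^ Suc k \<longleftrightarrow>
        (\<exists>l. (Y a \<omega>, Y l \<omega>) \<in> E \<omega> ^^ k \<and> (Y l \<omega>, Y n \<omega>) \<in> E \<omega>)" for \<omega>
    proof -
      have "\<exists>l. v = Y l \<omega>" if "(v, Y n \<omega>) \<in> E \<omega>" for v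
        using that by (auto simp: E_def rcm_def rcm_graph_def)
      then show ?thesis
        unfolding relpow.simps relcomp_unfold by blast
    qed
    then show ?case
      by (simp only:) measurable
  qed
  have "path_connected_in (rcm \<phi> Y U \<omega>) (Y a \<omega>) (Y b \<omega>) \<longleftrightarrow> (\<exists>k. (Y a \<omega>, Y b \<omega>) \<in> E \<omega> ^^ k)" for \<omega>
    unfolding path_connected_in_def E_def rtrancl_power
    by (auto simp: rcm_def rcm_graph_def)
  then show ?thesis
    by simp
qed

text \<open>
  The points are independent of the marks, and finitely many independent uniform marks are all at most
  \<open>c\<close> with positive probability.
\<close>

lemma marks_small_pos:
  assumes J: "J \<subseteq> index_pairs" "finite J" and c: "0 < c" "c \<le> 1"
    and S: "S \<in> sets (\<Pi>\<^sub>M n\<in>UNIV. borel)"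
    and pos: "emeasure \<Omega> {\<omega> \<in> space \<Omega>. (\<lambda>n. X n \<omega>) \<in> S} \<noteq> 0"
  shows "emeasure \<Omega> {\<omega> \<in> space \<Omega>. (\<lambda>n. X n \<omega>) \<in> S \<and> (\<forall>e\<in>J. U e \<omega> \<le> c)} \<noteq> 0"
proof -
  let ?u = "uniform_measure lborel {0..1 :: real}"
  let ?X = "\<lambda>\<omega> n. X n \<omega>" and ?U = "\<lambda>\<omega>. \<lambda>e\<in>index_pairs. U e \<omega>"
  have u: "prob_space ?u"
    by (rule prob_space_uniform_measure) auto
  interpret P: product_prob_space "\<lambda>_ :: nat set. ?u" index_pairs
    using u by (intro product_prob_spaceI)
  have X [measurable]: "?X \<in> \<Omega> \<rightarrow>\<^sub>M (\<Pi>\<^sub>M n\<in>UNIV. borel)"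
    by (rule measurable_PiM_single') (auto simp: space_PiM)
  have U [measurable]: "?U \<in> \<Omega> \<rightarrow>\<^sub>M (\<Pi>\<^sub>M e\<in>index_pairs. borel)"
    using marks by (intro measurable_restrict) (auto simp: edge_marks_def)
  define T where "T = {u \<in> space (\<Pi>\<^sub>M e\<in>index_pairs. ?u). \<forall>e\<in>J. u e \<in> {..c}}"
  have "emeasure (\<Pi>\<^sub>M e\<in>index_pairs. ?u) T = (\<Prod>e\<in>J. emeasure ?u {..c})"
    unfolding T_def using J by (intro P.emeasure_PiM_Collect) auto
  also have "emeasure ?u {..c} = ennreal c"
  proof -
    have "{0..1} \<inter> {..c} = {0..c}"
      using c by auto
    then show ?thesis
      using c by (simp add: divide_ennreal_def)
  qed
  finally have T_pos: "emeasure (\<Pi>\<^sub>M e\<in>index_pairs. ?u) T \<noteq> 0"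
    using c J by simp
  have T: "T \<in> sets (\<Pi>\<^sub>M e\<in>index_pairs. ?u)"
    unfolding T_def using J(1)
    by (intro sets.sets_Collect_finite_All J(2) sets_Collect_single') auto
  have sets_eq: "sets (\<Pi>\<^sub>M e\<in>index_pairs. ?u) = sets (\<Pi>\<^sub>M e\<in>index_pairs. borel)"
    by (intro sets_PiM_cong) auto
  have T' [measurable]: "T \<in> sets (\<Pi>\<^sub>M e\<in>index_pairs. borel)"
    using T sets_eq by simp
  note S [measurable]
  have "emeasure \<Omega> {\<omega> \<in> space \<Omega>. ?X \<omega> \<in> S \<and> (\<forall>e\<in>J. U e \<omega> \<le> c)} =
      emeasure (distr \<Omega> ((\<Pi>\<^sub>M n\<in>UNIV. borel) \<Otimes>\<^sub>M (\<Pi>\<^sub>M e\<in>index_pairs. borel)) (\<lambda>\<omega>. (?X \<omega>, ?U \<omega>))) (S \<times> T)"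
  proof (subst emeasure_distr)
    have "?U \<omega> \<in> T \<longleftrightarrow> (\<forall>e\<in>J. U e \<omega> \<le> c)" for \<omega>
      using J(1) by (auto simp: T_def space_PiM PiE_iff)
    then show "emeasure \<Omega> {\<omega> \<in> space \<Omega>. ?X \<omega> \<in> S \<and> (\<forall>e\<in>J. U e \<omega> \<le> c)} =
        emeasure \<Omega> ((\<lambda>\<omega>. (?X \<omega>, ?U \<omega>)) -` (S \<times> T) \<inter> space \<Omega>)"
      by (intro arg_cong[where f = "emeasure \<Omega>"]) auto
  qed measurable
  also have "\<dots> = emeasure (distr \<Omega> (\<Pi>\<^sub>M n\<in>UNIV. borel) ?X \<Otimes>\<^sub>M (\<Pi>\<^sub>M e\<in>index_pairs. ?u)) (S \<times> T)"
    using marks by (simp add: edge_marks_def)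
  also have "\<dots> = emeasure (distr \<Omega> (\<Pi>\<^sub>M n\<in>UNIV. borel) ?X) S * emeasure (\<Pi>\<^sub>M e\<in>index_pairs. ?u) T"
    using S T by (intro P.emeasure_pair_measure_Times) auto
  also have "emeasure (distr \<Omega> (\<Pi>\<^sub>M n\<in>UNIV. borel) ?X) S = emeasure \<Omega> {\<omega> \<in> space \<Omega>. ?X \<omega> \<in> S}"
    by (subst emeasure_distr) (auto intro!: arg_cong[where f = "emeasure \<Omega>"])
  finally show ?thesis
    using pos T_pos by simp
qed

text \<open>
  Along a chain all of whose edges have positive connection probability, these probabilities exceed
  some \<open>c > 0\<close> with positive probability, and independently of this all edge marks are at most \<open>c\<close>
  with positive probability. Only consecutive indices have to be distinct; the points themselves
  may coincide, for then the step of the path is void.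
\<close>

lemma path_connected_pos_if_chain:
  assumes i: "inj_on i {..<k}"
    and pos: "(\<integral>\<^sup>+ \<omega>. chain_weight \<phi> k z\<^sub>1 z\<^sub>2 (\<lambda>j\<in>{..<k}. X (i j) \<omega>) \<partial>\<Omega>) \<noteq> 0"
  shows "0 < measure \<Omega> {\<omega> \<in> space \<Omega>. path_connected_in (rcm \<phi> (add_two_points z\<^sub>1 z\<^sub>2 X) U \<omega>) z\<^sub>1 z\<^sub>2}"
proof -
  define y where "y x = case_nat z\<^sub>1 (case_nat z\<^sub>2 x)" for x :: "nat \<Rightarrow> 'x"
  \<comment> \<open>the indices along the chain: \<open>z\<^sub>1\<close> and \<open>z\<^sub>2\<close> are enumerated first, as points \<open>0\<close> and \<open>1\<close>\<close>
  define s where "s j = (if j = 0 then 0 else if j \<le> k then Suc (Suc (i (j - 1))) else 1)" for j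
  define Y where "Y = add_two_points z\<^sub>1 z\<^sub>2 X"
  have Y: "Y n \<omega> = y (\<lambda>n. X n \<omega>) n" for n \<omega>
    by (auto simp: Y_def y_def add_two_points_def split: nat.splits)
  have Y01: "Y 0 \<omega> = z\<^sub>1" "Y 1 \<omega> = z\<^sub>2" for \<omega>
    by (simp_all add: Y y_def)
  have [measurable]: "Y n \<in> borel_measurable \<Omega>" for n
    unfolding Y_def add_two_points_def by (auto split: nat.split)
  have y_meas [measurable]: "(\<lambda>x. y x n) \<in> borel_measurable (\<Pi>\<^sub>M n\<in>UNIV. borel)" for n
  proof (cases n)
    case (Suc m)
    then show ?thesis
      by (cases m) (simp_all add: y_def)
  qed (simp add: y_def)
  have vertex: "y x (s j) = chain_vertex k z\<^sub>1 z\<^sub>2 (\<lambda>j\<in>{..<k}. x (i j)) j" for x j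
    by (auto simp: y_def s_def chain_vertex_def)
  have s_neq: "s j \<noteq> s (Suc j)" if "j \<le> k" for j
  proof
    assume eq: "s j = s (Suc j)"
    then have "0 < j" "j < k" "i (j - 1) = i j"
      using that by (auto simp: s_def split: if_splits)
    then have "j - 1 = j"
      using that inj_onD[OF i, of "j - 1" j] by auto
    with \<open>0 < j\<close> show False
      by simp
  qed
  define S where "S n = {x \<in> space (\<Pi>\<^sub>M n\<in>UNIV. borel :: 'x measure).
    \<forall>j\<le>k. 1 / real (Suc n) \<le> \<phi> (y x (s j)) (y x (s (Suc j)))}" for n
  have S [measurable]: "S n \<in> sets (\<Pi>\<^sub>M n\<in>UNIV. borel)" for n
    unfolding S_def by measurable
  have X [measurable]: "(\<lambda>\<omega> n. X n \<omega>) \<in> \<Omega> \<rightarrow>\<^sub>M (\<Pi>\<^sub>M n\<in>UNIV. borel)"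
    by (rule measurable_PiM_single') (auto simp: space_PiM)
  have "\<exists>n. emeasure \<Omega> {\<omega> \<in> space \<Omega>. (\<lambda>n. X n \<omega>) \<in> S n} \<noteq> 0"
  proof (rule ccontr)
    assume "\<not> ?thesis"
    then have "AE \<omega> in \<Omega>. (\<lambda>n. X n \<omega>) \<notin> S n" for n
      by (subst AE_iff_measurable[OF _ refl]) auto
    then have "AE \<omega> in \<Omega>. \<forall>n. (\<lambda>n. X n \<omega>) \<notin> S n"
      by (simp add: AE_all_countable)
    then have "AE \<omega> in \<Omega>. chain_weight \<phi> k z\<^sub>1 z\<^sub>2 (\<lambda>j\<in>{..<k}. X (i j) \<omega>) = 0"
    proof eventually_elim
      case (elim \<omega>)
      show ?case
      proof (rule ccontr)
        assume "\<not> ?case"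
        then have \<phi>_pos: "0 < \<phi> (y (\<lambda>n. X n \<omega>) (s j)) (y (\<lambda>n. X n \<omega>) (s (Suc j)))" if "j \<le> k" for j
          using that unfolding chain_weight_neq_0_iff vertex by blast
        define c where "c = Min ((\<lambda>j. \<phi> (y (\<lambda>n. X n \<omega>) (s j)) (y (\<lambda>n. X n \<omega>) (s (Suc j)))) ` {..k})"
        have "0 < c"
          unfolding c_def using \<phi>_pos by (subst Min_gr_iff) auto
        then obtain n where "1 / real (Suc n) < c"
          using nat_approx_posE by blast
        moreover have "c \<le> \<phi> (y (\<lambda>n. X n \<omega>) (s j)) (y (\<lambda>n. X n \<omega>) (s (Suc j)))" if "j \<le> k" for j
          unfolding c_def using that by (intro Min_le) auto
        ultimately have "(\<lambda>n. X n \<omega>) \<in> S n"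
          by (force simp: S_def space_PiM)
        with elim show False
          by blast
      qed
    qed
    then have "(\<integral>\<^sup>+ \<omega>. chain_weight \<phi> k z\<^sub>1 z\<^sub>2 (\<lambda>j\<in>{..<k}. X (i j) \<omega>) \<partial>\<Omega>) = (\<integral>\<^sup>+ \<omega>. 0 \<partial>\<Omega>)"
      by (rule nn_integral_cong_AE)
    with pos show False
      by simp
  qed
  then obtain n where n: "emeasure \<Omega> {\<omega> \<in> space \<Omega>. (\<lambda>n. X n \<omega>) \<in> S n} \<noteq> 0"
    by blast
  define J where "J = (\<lambda>j. {s j, s (Suc j)}) ` {..k}"
  let ?G = "{\<omega> \<in> space \<Omega>. (\<lambda>n. X n \<omega>) \<in> S n \<and> (\<forall>e\<in>J. U e \<omega> \<le> 1 / real (Suc n))}"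
  let ?C = "{\<omega> \<in> space \<Omega>. path_connected_in (rcm \<phi> Y U \<omega>) (Y 0 \<omega>) (Y 1 \<omega>)}"
  have "emeasure \<Omega> ?G \<noteq> 0"
    using s_neq by (intro marks_small_pos S n) (auto simp: J_def index_pairs_def)
  moreover have "?G \<subseteq> ?C"
  proof clarify
    fix \<omega> assume \<omega>: "(\<lambda>n. X n \<omega>) \<in> S n" "\<forall>e\<in>J. U e \<omega> \<le> 1 / real (Suc n)"
    let ?E = "snd (rcm \<phi> Y U \<omega>)"
    have step: "(Y (s j) \<omega>, Y (s (Suc j)) \<omega>) \<in> ?E\<^sup>*" if j: "j \<le> k" for j
    proof (cases "Y (s j) \<omega> = Y (s (Suc j)) \<omega>")
      case False
      have "U {s j, s (Suc j)} \<omega> \<le> \<phi> (Y (s j) \<omega>) (Y (s (Suc j)) \<omega>)"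
      proof (rule order_trans)
        show "U {s j, s (Suc j)} \<omega> \<le> 1 / real (Suc n)"
          using \<omega>(2) j unfolding J_def by blast
        show "1 / real (Suc n) \<le> \<phi> (Y (s j) \<omega>) (Y (s (Suc j)) \<omega>)"
          using \<omega>(1) j unfolding S_def Y by blast
      qed
      with False show ?thesis
        by (intro r_into_rtrancl) (auto simp: rcm_def rcm_graph_def)
    qed simp
    have "(Y (s 0) \<omega>, Y (s j) \<omega>) \<in> ?E\<^sup>*" if "j \<le> Suc k" for j
      using that by (induction j) (auto intro: rtrancl_trans step)
    from this[of "Suc k"] have "(Y 0 \<omega>, Y 1 \<omega>) \<in> ?E\<^sup>*"
      by (simp add: s_def)
    then show "path_connected_in (rcm \<phi> Y U \<omega>) (Y 0 \<omega>) (Y 1 \<omega>)"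
      by (auto simp: path_connected_in_def rcm_def rcm_graph_def)
  qed
  then have "emeasure \<Omega> ?G \<le> emeasure \<Omega> ?C"
    by (intro emeasure_mono path_connected_event) auto
  ultimately have "emeasure \<Omega> ?C \<noteq> 0"
    by auto
  then show ?thesis
    unfolding Y_def[symmetric] Y01
    by (simp add: Omega.emeasure_eq_measure zero_less_measure_iff)
qed

end


section \<open>Irreducibility of the random connection model\<close>

text \<open>
  The factor \<open>\<real>\<^sup>d\<close> makes the intensity diffuse, whatever the mark distribution.
\<close>

lemma (in connection_model) diffuse_intensity:
  assumes "t > 0"
  shows "diffuse_measure (scale_measure (ennreal t) L)"
proof (intro diffuse_measure.intro diffuse_measure_axioms.intro)
  show "sigma_finite_measure (scale_measure (ennreal t) L)"
    by (intro sigma_finite_scale_measure sigma_finite_marked_lebesgue)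
  show "sets (scale_measure (ennreal t) L) = sets borel"
    by (simp add: sets_marked_lebesgue)
  show "emeasure (scale_measure (ennreal t) L) {z} = 0" for z
  proof -
    have "{z} = {fst z} \<times> {snd z}"
      by auto
    then have "emeasure L {z} = emeasure lborel {fst z} * emeasure Q {snd z}"
      unfolding marked_lebesgue_def by (simp only:) (rule emeasure_pair_measure_Times, simp_all add: sets_Q)
    then show ?thesis
      by simp
  qed
qed

theorem theorem5p11:
  fixes \<Omega> :: "'w measure"
    and Q :: "'m::polish_space measure"
    and \<phi> :: "'a::euclidean_space \<times> 'm \<Rightarrow> 'a \<times> 'm \<Rightarrow> real"
    and \<eta> :: "'w \<Rightarrow> ('a \<times> 'm) measure"
    and X :: "nat \<Rightarrow> 'w \<Rightarrow> 'a \<times> 'm"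
    and U :: "nat set \<Rightarrow> 'w \<Rightarrow> real"
    and t :: real and A :: "'m set" and p\<^sub>0 :: 'm
  assumes "prob_space \<Omega>"
    and "prob_space Q" and "sets Q = sets borel"
    and "stationary_connection_function Q \<phi>"
    and "t > 0"
    and "poisson_process \<Omega> (scale_measure (ennreal t) (marked_lebesgue Q)) \<eta>"
    and "enumerates_points \<Omega> \<eta> X"
    and "edge_marks \<Omega> X U"
    and "A \<in> sets Q" and "emeasure Q A > 0"
    and "AE (p, q) in Q \<Otimes>\<^sub>M Q. q \<in> A \<longrightarrow> conn_degree Q \<phi> 1 p q \<ge> conn_degree Q \<phi> 1 p p\<^sub>0"
    and "AE q in Q. (SUP n\<in>{1..}. conn_degree Q \<phi> n p\<^sub>0 q) > 0"
  shows "rcm_irreducible \<Omega> (marked_lebesgue Q) \<phi> X U"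
proof -
  interpret Q: prob_space Q by fact
  interpret dominated_connection_model Q \<phi> A p\<^sub>0
  proof
    show "AE (p, q) in Q \<Otimes>\<^sub>M Q. q \<in> A \<longrightarrow> conn_degree Q \<phi> (Suc 0) p p\<^sub>0 \<le> conn_degree Q \<phi> (Suc 0) p q"
      using assms(11) by simp
  qed (fact assms)+
  let ?M = "scale_measure (ennreal t) L"
  interpret M: diffuse_measure ?M
    by (rule diffuse_intensity) fact
  interpret \<Omega>: prob_space \<Omega> by fact
  interpret poisson_points ?M \<Omega> \<eta> X
    by unfold_locales (fact assms)+
  interpret rcm_marks \<Omega> \<phi> X U
  proof
    show "(\<lambda>(z, w). \<phi> z w) \<in> borel_measurable (borel \<Otimes>\<^sub>M borel)"
      unfolding split_beta' by measurable
  qed (use assms in auto)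
  note [measurable] = conn_iter_measurable[OF M.sigma_finite_measure_axioms M.sets_mu]
  have "AE (z\<^sub>1, z\<^sub>2) in L \<Otimes>\<^sub>M L. \<exists>k. conn_iter ?M \<phi> (Suc k) z\<^sub>1 z\<^sub>2 \<noteq> 0"
  proof (rule LL.AE_pair_measure)
    show "{z \<in> space (L \<Otimes>\<^sub>M L). case z of (z\<^sub>1, z\<^sub>2) \<Rightarrow> \<exists>k. conn_iter ?M \<phi> (Suc k) z\<^sub>1 z\<^sub>2 \<noteq> 0}
        \<in> sets (L \<Otimes>\<^sub>M L)"
      unfolding split_beta' by measurable
    show "AE z\<^sub>1 in L. AE z\<^sub>2 in L. case (z\<^sub>1, z\<^sub>2) of (z\<^sub>1, z\<^sub>2) \<Rightarrow> \<exists>k. conn_iter ?M \<phi> (Suc k) z\<^sub>1 z\<^sub>2 \<noteq> 0"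
      unfolding prod.case by (rule AE_AE_conn_iter_pos) fact
  qed
  then show ?thesis
    unfolding rcm_irreducible_def
  proof (rule eventually_mono, simp only: split_paired_all prod.case, elim exE)
    fix z\<^sub>1 z\<^sub>2 k
    assume "conn_iter ?M \<phi> (Suc k) z\<^sub>1 z\<^sub>2 \<noteq> 0"
    then have pos: "(\<integral>\<^sup>+ x. chain_weight \<phi> k z\<^sub>1 z\<^sub>2 x \<partial>(\<Pi>\<^sub>M j\<in>{..<k}. ?M)) \<noteq> 0"
      by (simp add: nn_integral_chain_weight[OF M.diffuse_measure_axioms])
    have meas: "chain_weight \<phi> k z\<^sub>1 z\<^sub>2 \<in> borel_measurable (\<Pi>\<^sub>M j\<in>{..<k}. ?M)"
    proof (rule chain_weight_measurable)
      show "(\<lambda>x. x j) \<in> borel_measurable (\<Pi>\<^sub>M j\<in>{..<k}. ?M)" if "j < k" for j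
        using measurable_component_singleton[of j "{..<k}" "\<lambda>_. ?M"] that
        by (simp add: measurable_cong_sets[OF refl M.sets_mu])
    qed simp
    from points_hit_nonnull_functions[OF meas pos] obtain i
      where "inj_on i {..<k}" "(\<integral>\<^sup>+ \<omega>. chain_weight \<phi> k z\<^sub>1 z\<^sub>2 (\<lambda>j\<in>{..<k}. X (i j) \<omega>) \<partial>\<Omega>) \<noteq> 0"
      by blast
    then show "0 < measure \<Omega> {\<omega> \<in> space \<Omega>.
        path_connected_in (rcm \<phi> (add_two_points z\<^sub>1 z\<^sub>2 X) U \<omega>) z\<^sub>1 z\<^sub>2}"
      by (rule path_connected_pos_if_chain)
  qed
qed

end
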